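(* Suppose that the local ring $(R,\mathfrak m)$ of prime characteristic $p$ is $F$-pure and $F$-finite. Then every $\Phi(E)$-special ideal of $R$ is fully $\Phi(E)$-special.
   Context: $(R,\mathfrak m)$ is a commutative Noetherian local ring of prime characteristic $p$, with Frobenius homomorphism $f(r)=r^p$. $R^{(1)}$ denotes $R$ as a left $R$-module in the usual way and as a right $R$-module via $f$. $R$ is $F$-finite if $R^{(1)}$ is a finitely generated left $R$-module; $R$ is $F$-pure if for every $R$-module $M$ the natural map $M\to R^{(1)}\otimes_R M$, $m\mapsto1\otimes m$, is injective. The Frobenius skew polynomial ring $R[x,f]$ consists of polynomials $\sum_{i=0}^n r_ix^i$, free as a left $R$-module on $(x^i)_{i\ge0}$, with $xr=r^px$; it is graded with $n$th component $Rx^n$. Let $E=E_R(R/\mathfrak m)$, and $\Phi(E)=R[x,f]\otimes_R E=\bigoplus_{n\ge0}Rx^n\otimes_RE$, graded left $R[x,f]$-module with $0$th component identified with $E$. An ideal $\mathfrak a$ is $\Phi(E)$-special if $\mathfrak a=(0:_RN)$ for some $R[x,f]$-submodule $N$ of $\Phi(E)$. $\operatorname{ann}_{\Phi(E)}(\mathfrak aR[x,f])$ is the submodule of elements of $\Phi(E)$ annihilated by all $rx^n$ with $r\in\mathfrak a$, $n\ge0$; $(\cdot)_0$ is its $0$th component. When $R$ is $F$-pure, $\mathfrak a$ is fully $\Phi(E)$-special if $(0:_E\mathfrak a)\subseteq(\operatorname{ann}_{\Phi(E)}(\mathfrak aR[x,f]))_0$. *)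

theory Defs
  imports "HOL-Algebra.Algebra"
begin

definition local_ring_max :: "'a ring \<Rightarrow> 'a set \<Rightarrow> bool" where
  "local_ring_max R m \<longleftrightarrow> maximalideal m R \<and> (\<forall>I. maximalideal I R \<longrightarrow> I = m)"

definition char_p_local_noetherian :: "'a ring \<Rightarrow> 'a set \<Rightarrow> nat \<Rightarrow> bool" where
  "char_p_local_noetherian R m p \<longleftrightarrow>
     cring R \<and> noetherian_ring R \<and> local_ring_max R m \<and>
     Factorial_Ring.prime p \<and> [p] \<cdot>\<^bsub>R\<^esub> \<one>\<^bsub>R\<^esub> = \<zero>\<^bsub>R\<^esub>"

abbreviation frob_pow :: "'a ring \<Rightarrow> nat \<Rightarrow> nat \<Rightarrow> 'a \<Rightarrow> 'a" where
  "frob_pow R p n r \<equiv> r [^]\<^bsub>R\<^esub> (p ^ n)"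

text \<open>R^(1) (R with R acting through the Frobenius) is a finitely generated R-module:
  there is a finite set S such that every r is a combination  sum of s * c_s^p.\<close>
definition F_finite :: "'a ring \<Rightarrow> nat \<Rightarrow> bool" where
  "F_finite R p \<longleftrightarrow>
     (\<exists>S. finite S \<and> S \<subseteq> carrier R \<and>
        (\<forall>r \<in> carrier R. \<exists>c. c \<in> S \<rightarrow> carrier R \<and>
            r = (\<Oplus>\<^bsub>R\<^esub> s \<in> S. s \<otimes>\<^bsub>R\<^esub> (c s [^]\<^bsub>R\<^esub> p))))"

text \<open>Elements of the free abelian group on  'i \<times> R \<times> M : finitely supported integer-valued
  functions whose support consists of triples (i, r, m) with r \<in> R and m \<in> M.
  A generator (i, r, m) stands for the pure tensor  r x^(q i) \<otimes> m, where the right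
  R-structure of R x^k is  (r x^k) s = r s^(p^k) x^k.\<close>

definition gen :: "'k \<Rightarrow> ('k \<Rightarrow> int)" where
  "gen k = (\<lambda>j. if j = k then 1 else 0)"

definition fadd :: "('k \<Rightarrow> int) \<Rightarrow> ('k \<Rightarrow> int) \<Rightarrow> ('k \<Rightarrow> int)" where
  "fadd y z = (\<lambda>k. y k + z k)"

definition fneg :: "('k \<Rightarrow> int) \<Rightarrow> ('k \<Rightarrow> int)" where
  "fneg y = (\<lambda>k. - y k)"

definition fsub :: "('k \<Rightarrow> int) \<Rightarrow> ('k \<Rightarrow> int) \<Rightarrow> ('k \<Rightarrow> int)" where
  "fsub y z = (\<lambda>k. y k - z k)"

definition in_free :: "'a ring \<Rightarrow> ('a, 'b) module \<Rightarrow> ('i \<times> 'a \<times> 'b \<Rightarrow> int) \<Rightarrow> bool" where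
  "in_free R M y \<longleftrightarrow> finite {k. y k \<noteq> 0} \<and>
     (\<forall>i r m. y (i, r, m) \<noteq> 0 \<longrightarrow> r \<in> carrier R \<and> m \<in> carrier M)"

inductive_set tens_rel :: "'a ring \<Rightarrow> ('a, 'b) module \<Rightarrow> ('i \<Rightarrow> nat) \<Rightarrow>
    ('i \<times> 'a \<times> 'b \<Rightarrow> int) set"
  for R M q where
  zero: "(\<lambda>_. 0) \<in> tens_rel R M q"
| add_l: "\<lbrakk>r \<in> carrier R; s \<in> carrier R; m \<in> carrier M\<rbrakk> \<Longrightarrow>
     fsub (fsub (gen (i, r \<oplus>\<^bsub>R\<^esub> s, m)) (gen (i, r, m))) (gen (i, s, m)) \<in> tens_rel R M q"
| add_r: "\<lbrakk>r \<in> carrier R; m \<in> carrier M; m' \<in> carrier M\<rbrakk> \<Longrightarrow>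
     fsub (fsub (gen (i, r, m \<oplus>\<^bsub>M\<^esub> m')) (gen (i, r, m))) (gen (i, r, m')) \<in> tens_rel R M q"
| balanced: "\<lbrakk>r \<in> carrier R; s \<in> carrier R; m \<in> carrier M\<rbrakk> \<Longrightarrow>
     fsub (gen (i, r \<otimes>\<^bsub>R\<^esub> (s [^]\<^bsub>R\<^esub> q i), m)) (gen (i, r, s \<odot>\<^bsub>M\<^esub> m)) \<in> tens_rel R M q"
| plus: "\<lbrakk>y \<in> tens_rel R M q; z \<in> tens_rel R M q\<rbrakk> \<Longrightarrow> fadd y z \<in> tens_rel R M q"
| uminus: "y \<in> tens_rel R M q \<Longrightarrow> fneg y \<in> tens_rel R M q"

text \<open>The map M \<rightarrow> R^(1) \<otimes>_R M, m \<mapsto> 1 \<otimes> m, is injective.  Here R^(1) \<otimes>_R M is the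
  quotient of the free abelian group on unit \<times> R \<times> M by tens_rel with exponent p.\<close>
definition frob_tensor_injective :: "'a ring \<Rightarrow> nat \<Rightarrow> ('a, 'b) module \<Rightarrow> bool" where
  "frob_tensor_injective R p M \<longleftrightarrow>
     (\<forall>m \<in> carrier M. gen ((), \<one>\<^bsub>R\<^esub>, m) \<in> tens_rel R M (\<lambda>_::unit. p) \<longrightarrow> m = \<zero>\<^bsub>M\<^esub>)"

definition F_pure :: "'a ring \<Rightarrow> nat \<Rightarrow> bool" where
  "F_pure R p \<longleftrightarrow>
     (\<forall>M :: ('a, 'a \<times> nat) module. module R M \<longrightarrow> frob_tensor_injective R p M)"

definition lin_on_ideal :: "'a ring \<Rightarrow> ('a, 'b) module \<Rightarrow> 'a set \<Rightarrow> ('a \<Rightarrow> 'b) \<Rightarrow> bool" where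
  "lin_on_ideal R E I g \<longleftrightarrow>
     (\<forall>r \<in> I. g r \<in> carrier E) \<and>
     (\<forall>r \<in> I. \<forall>s \<in> I. g (r \<oplus>\<^bsub>R\<^esub> s) = g r \<oplus>\<^bsub>E\<^esub> g s) \<and>
     (\<forall>a \<in> carrier R. \<forall>r \<in> I. g (a \<otimes>\<^bsub>R\<^esub> r) = a \<odot>\<^bsub>E\<^esub> g r)"

text \<open>Injectivity of E (Baer's criterion).\<close>
definition injective_module :: "'a ring \<Rightarrow> ('a, 'b) module \<Rightarrow> bool" where
  "injective_module R E \<longleftrightarrow>
     (\<forall>I g. ideal I R \<and> lin_on_ideal R E I g \<longrightarrow>
        (\<exists>e \<in> carrier E. \<forall>r \<in> I. g r = r \<odot>\<^bsub>E\<^esub> e))"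

text \<open>E is an injective hull of R/m: E is injective and contains an essential submodule
  R e0 isomorphic to R/m (i.e. the annihilator of e0 is exactly m).\<close>
definition injective_hull_residue :: "'a ring \<Rightarrow> 'a set \<Rightarrow> ('a, 'b) module \<Rightarrow> bool" where
  "injective_hull_residue R m E \<longleftrightarrow>
     module R E \<and> injective_module R E \<and>
     (\<exists>e0 \<in> carrier E.
        (\<forall>r \<in> carrier R. r \<odot>\<^bsub>E\<^esub> e0 = \<zero>\<^bsub>E\<^esub> \<longleftrightarrow> r \<in> m) \<and>
        (\<forall>N. submodule N R E \<and> N \<noteq> {\<zero>\<^bsub>E\<^esub>} \<longrightarrow>
             N \<inter> {r \<odot>\<^bsub>E\<^esub> e0 | r. r \<in> carrier R} \<noteq> {\<zero>\<^bsub>E\<^esub>}))"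

text \<open>Phi(E) = \<Oplus>_n R x^n \<otimes>_R E is the quotient of the free abelian group on nat \<times> R \<times> E
  (generator (n, r, e) = r x^n \<otimes> e) by tens_rel with exponents p^n.\<close>
abbreviation phi_rel :: "'a ring \<Rightarrow> ('a, 'b) module \<Rightarrow> nat \<Rightarrow> (nat \<times> 'a \<times> 'b \<Rightarrow> int) set" where
  "phi_rel R E p \<equiv> tens_rel R E (\<lambda>n. p ^ n)"

text \<open>Left action of the monomial c x^k of R[x,f] on the free group (linear extension of
  c x^k \<cdot> (r x^n \<otimes> e) = c r^(p^k) x^(k+n) \<otimes> e).\<close>
definition phi_act :: "'a ring \<Rightarrow> nat \<Rightarrow> 'a \<Rightarrow> nat \<Rightarrow> (nat \<times> 'a \<times> 'b \<Rightarrow> int) \<Rightarrow> (nat \<times> 'a \<times> 'b \<Rightarrow> int)" where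
  "phi_act R p c k y = (\<lambda>(j, s, e).
     \<Sum>(n, r) \<in> {(n, r). y (n, r, e) \<noteq> 0 \<and> k + n = j \<and> c \<otimes>\<^bsub>R\<^esub> (r [^]\<^bsub>R\<^esub> (p ^ k)) = s}.
        y (n, r, e))"

text \<open>An R[x,f]-submodule of Phi(E), represented by its preimage in the free group
  (a set of free elements containing all relations, closed under the group operations
  and under the action of all monomials c x^k; these generate R[x,f] additively).\<close>
definition phi_submodule :: "'a ring \<Rightarrow> ('a, 'b) module \<Rightarrow> nat \<Rightarrow> (nat \<times> 'a \<times> 'b \<Rightarrow> int) set \<Rightarrow> bool" where
  "phi_submodule R E p N \<longleftrightarrow>
     (\<forall>y \<in> N. in_free R E y) \<and> phi_rel R E p \<subseteq> N \<and>
     (\<forall>y \<in> N. \<forall>z \<in> N. fadd y z \<in> N) \<and> (\<forall>y \<in> N. fneg y \<in> N) \<and>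
     (\<forall>y \<in> N. \<forall>c \<in> carrier R. \<forall>k. phi_act R p c k y \<in> N)"

definition phi_ann :: "'a ring \<Rightarrow> ('a, 'b) module \<Rightarrow> nat \<Rightarrow> (nat \<times> 'a \<times> 'b \<Rightarrow> int) set \<Rightarrow> 'a set" where
  "phi_ann R E p N = {r \<in> carrier R. \<forall>y \<in> N. phi_act R p r 0 y \<in> phi_rel R E p}"

definition phi_special :: "'a ring \<Rightarrow> ('a, 'b) module \<Rightarrow> nat \<Rightarrow> 'a set \<Rightarrow> bool" where
  "phi_special R E p a \<longleftrightarrow> (\<exists>N. phi_submodule R E p N \<and> a = phi_ann R E p N)"

text \<open>(0 :_E a) is contained in the degree-0 part of ann_Phi(E)(a R[x,f]); the element e of E
  is identified with 1 \<otimes> e = generator (0, 1, e) of degree 0.\<close>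
definition fully_phi_special :: "'a ring \<Rightarrow> ('a, 'b) module \<Rightarrow> nat \<Rightarrow> 'a set \<Rightarrow> bool" where
  "fully_phi_special R E p a \<longleftrightarrow>
     (\<forall>e \<in> carrier E. (\<forall>r \<in> a. r \<odot>\<^bsub>E\<^esub> e = \<zero>\<^bsub>E\<^esub>) \<longrightarrow>
        (\<forall>r \<in> a. \<forall>k. phi_act R p r k (gen (0, \<one>\<^bsub>R\<^esub>, e)) \<in> phi_rel R E p))"

end

theory Submission
  imports Defs "HOL-Library.Function_Algebras"
begin

text \<open>Write $G_k$ for $R$ viewed as an $R$-module through the $k$-fold Frobenius. An $R$-linear form
  $\phi : G_k \to R$ induces $\phi \otimes \mathrm{id} : G_k \otimes R x^n \otimes E \to R x^n \otimes E$,
  which sends $r x^k y$ to $\phi(r) y$. So if $\mathfrak a$ annihilates a submodule $N$ stable under $x$,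
  then so does $\phi(\mathfrak a)$, and special ideals satisfy $\phi(\mathfrak a) \subseteq \mathfrak a$.
  Conversely, $G_k$ is finitely presented and $E$ is injective, so the natural map
  $G_k \otimes E \to \mathrm{Hom}(\mathrm{Hom}(G_k, R), E)$ is injective. For $r \in \mathfrak a$ and
  $\mathfrak a e = 0$ it sends $r \otimes e$ to the map $\phi \mapsto \phi(r) e = 0$, hence $r x^k \otimes e = 0$.\<close>

section \<open>The Frobenius map\<close>

text \<open>The injectivity asserted for G_k \<otimes> E becomes a solvability statement. Write r =
  sum of s c_s^(p^k) over finitely many generators s of G_k, so that r \<otimes> e = sum of s
  \<otimes> c_s e. This tensor vanishes as soon as the vector (c_s e) is a combination, with
  coefficients in E, of finitely many relation vectors between the generators. Finding the
  coefficients is a finite linear system with unknowns in E, and injectivity makes it solvable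
  whenever each vector v over R orthogonal to the relations is orthogonal to (c_s e) as well. Such
  vectors v are exactly the forms \<phi>, with v_s = \<phi>(s), and pairing v with (c_s e) gives
  \<phi>(r) e. The shape of the remaining arguments comes from the tensor product being a quotient
  of formal sums: a map out of it is given on generators and then checked on every kind of
  relation.\<close>

context cring
begin

text \<open>Pascal's rule splits the term of index i + 1 into a times the term of index i plus b
  times the term of index i + 1. The coefficients act through \<open>add_pow\<close>, since natural
  numbers are not elements of \<open>R\<close>.\<close>

lemma binomial_ring:
  assumes a: "a \<in> carrier R" and b: "b \<in> carrier R"
  shows "(a \<oplus> b) [^] (n::nat) =
    (\<Oplus>i\<in>{..n}. add_pow R (n choose i) (a [^] i \<otimes> b [^] (n - i)))"
proof (induction n)
  case 0
  show ?case using a b by simp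
next
  case (Suc n)
  define T where "T n i = add_pow R (n choose i) (a [^] i \<otimes> b [^] (n - i))" for n i :: nat
  have T: "T n i \<in> carrier R" for n i
    using a b by (simp add: T_def)
  have T0: "T (Suc n) 0 = b \<otimes> T n 0"
    using a b by (simp add: T_def m_comm)
  have TS: "T (Suc n) (Suc i) = a \<otimes> T n i \<oplus> b \<otimes> T n (Suc i)" if "i \<in> {..n}" for i
  proof -
    have 1: "a \<otimes> T n i = add_pow R (n choose i) (a [^] Suc i \<otimes> b [^] (n - i))"
      using a b by (simp add: T_def add_pow_rdistr m_ac)
    \<comment> \<open>Subtraction is truncated: at i = n the factor b does not raise the exponent
      \<open>n - Suc i\<close> to \<open>n - i\<close>, but there the binomial coefficient is
      zero.\<close>
    have 2: "b \<otimes> T n (Suc i) = add_pow R (n choose Suc i) (a [^] Suc i \<otimes> b [^] (n - i))"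
    proof (cases "i = n")
      case True
      then show ?thesis using a b by (simp add: T_def binomial_eq_0)
    next
      case False
      with that have "n - i = Suc (n - Suc i)" by simp
      then show ?thesis using a b by (simp add: T_def add_pow_rdistr m_ac)
    qed
    show ?thesis
      unfolding 1 2 using a b by (simp add: T_def add.nat_pow_mult del: nat_pow_Suc)
  qed
  \<comment> \<open>This vanishing top term lets the shifted sum and its missing term of index 0 be
    joined into one sum over \<open>{..Suc n}\<close> and then cut back to
    \<open>{..n}\<close>.\<close>
  have last: "b \<otimes> T n (Suc n) = \<zero>"
    using a b by (simp add: T_def binomial_eq_0)
  have "(\<Oplus>i\<in>{..Suc n}. T (Suc n) i) = (\<Oplus>i\<in>{..n}. T (Suc n) (Suc i)) \<oplus> T (Suc n) 0"
    using T by (simp add: finsum_Suc2 del: finsum_Suc)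
  also have "(\<Oplus>i\<in>{..n}. T (Suc n) (Suc i)) = (\<Oplus>i\<in>{..n}. a \<otimes> T n i \<oplus> b \<otimes> T n (Suc i))"
    using T a b by (intro finsum_cong') (auto simp: TS)
  also have "\<dots> = (\<Oplus>i\<in>{..n}. a \<otimes> T n i) \<oplus> (\<Oplus>i\<in>{..n}. b \<otimes> T n (Suc i))"
    using T a b by (intro finsum_addf) auto
  also have "\<dots> \<oplus> T (Suc n) 0 =
      (\<Oplus>i\<in>{..n}. a \<otimes> T n i) \<oplus> ((\<Oplus>i\<in>{..n}. b \<otimes> T n (Suc i)) \<oplus> b \<otimes> T n 0)"
    unfolding T0 using T a b by (intro a_assoc finsum_closed) auto
  also have "(\<Oplus>i\<in>{..n}. b \<otimes> T n (Suc i)) \<oplus> b \<otimes> T n 0 = (\<Oplus>i\<in>{..Suc n}. b \<otimes> T n i)"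
    using T b by (simp add: finsum_Suc2 del: finsum_Suc)
  also have "\<dots> = (\<Oplus>i\<in>{..n}. b \<otimes> T n i)"
    using T b by (simp add: finsum_Suc last)
  also have "(\<Oplus>i\<in>{..n}. a \<otimes> T n i) \<oplus> \<dots> = (a \<oplus> b) \<otimes> (\<Oplus>i\<in>{..n}. T n i)"
    using T a b by (simp add: finsum_rdistr l_distr Pi_def)
  also have "\<dots> = (a \<oplus> b) [^] Suc n"
    using a b by (simp add: Suc.IH T_def m_comm Pi_def)
  finally show ?case by (simp add: T_def)
qed

text \<open>The prime p divides every inner binomial coefficient, and multiples of p act as zero
  because p times 1 is zero.\<close>

lemma freshmans_dream:
  assumes p: "Factorial_Ring.prime (p::nat)" and char: "add_pow R p \<one> = \<zero>"
    and a: "a \<in> carrier R" and b: "b \<in> carrier R"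
  shows "(a \<oplus> b) [^] p = a [^] p \<oplus> b [^] p"
proof -
  have kill: "add_pow R n x = \<zero>" if "p dvd n" and x: "x \<in> carrier R" for n x
  proof -
    from that obtain k where "n = p * k" by (auto elim: dvdE)
    then have "add_pow R n \<one> = \<zero>"
      using char by (metis add.nat_pow_pow add.nat_pow_one one_closed)
    then show ?thesis using add_pow_ldistr[of \<one> x n] x by simp
  qed
  \<comment> \<open>Positivity makes 0 and p distinct indices, so that two separate terms
    survive.\<close>
  have "p > 0" using p by (simp add: prime_gt_0_nat)
  then obtain k where k: "p = Suc k" by (cases p) auto
  let ?T = "\<lambda>i. add_pow R (p choose i) (a [^] i \<otimes> b [^] (p - i))"
  have zero: "?T i = \<zero>" if "i \<noteq> 0" "i \<noteq> p" "i \<le> p" for i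
    using that a b p by (intro kill) (auto intro!: dvd_choose_prime)
  have "(\<Oplus>i\<in>{..p}. ?T i) = (\<Oplus>i\<in>{0,p}. ?T i)"
    using a b zero by (intro add.finprod_mono_neutral_cong_right) auto
  also have "\<dots> = a [^] p \<oplus> b [^] p"
    using a b k by (simp add: a_comm Pi_def)
  finally show ?thesis using a b by (simp add: binomial_ring)
qed

lemma freshmans_dream_power:
  assumes p: "Factorial_Ring.prime (p::nat)" and char: "add_pow R p \<one> = \<zero>"
    and a: "a \<in> carrier R" and b: "b \<in> carrier R"
  shows "(a \<oplus> b) [^] (p ^ k) = a [^] (p ^ k) \<oplus> b [^] (p ^ k)"
proof (induction k)
  case 0
  show ?case using a b by simp
next
  case (Suc k)
  have "x [^] (p ^ Suc k) = (x [^] (p ^ k)) [^] p" if "x \<in> carrier R" for x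
    using that by (simp add: nat_pow_pow mult.commute)
  then show ?case using a b Suc freshmans_dream[OF p char] by simp
qed

end

section \<open>Linear systems over Noetherian rings and injective modules\<close>

definition vec_dot :: "('a, 'c) ring_scheme \<Rightarrow> 's set \<Rightarrow> ('s \<Rightarrow> 'a) \<Rightarrow> ('s \<Rightarrow> 'a) \<Rightarrow> 'a" where
  "vec_dot R S v w = (\<Oplus>\<^bsub>R\<^esub>s\<in>S. v s \<otimes>\<^bsub>R\<^esub> w s)"

text \<open>Vectors are indexed by a whole type; only their coordinates in a finite index set will matter.\<close>
definition vec_submodule :: "('a, 'c) ring_scheme \<Rightarrow> ('s \<Rightarrow> 'a) set \<Rightarrow> bool" where
  "vec_submodule R K \<longleftrightarrow> K \<subseteq> (UNIV \<rightarrow> carrier R) \<and> (\<lambda>_. \<zero>\<^bsub>R\<^esub>) \<in> K \<and>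
     (\<forall>v\<in>K. \<forall>w\<in>K. (\<lambda>s. v s \<oplus>\<^bsub>R\<^esub> w s) \<in> K) \<and>
     (\<forall>c\<in>carrier R. \<forall>v\<in>K. (\<lambda>s. c \<otimes>\<^bsub>R\<^esub> v s) \<in> K)"

context cring
begin

lemma vec_dot_closed [simp]:
  "v \<in> UNIV \<rightarrow> carrier R \<Longrightarrow> w \<in> UNIV \<rightarrow> carrier R \<Longrightarrow> vec_dot R S v w \<in> carrier R"
  unfolding vec_dot_def by (intro finsum_closed) auto

lemma vec_dot_add:
  assumes "u \<in> UNIV \<rightarrow> carrier R" "v \<in> UNIV \<rightarrow> carrier R" "w \<in> UNIV \<rightarrow> carrier R"
  shows "vec_dot R S u (\<lambda>s. v s \<oplus> w s) = vec_dot R S u v \<oplus> vec_dot R S u w"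
proof -
  have c: "\<And>s. u s \<in> carrier R" "\<And>s. v s \<in> carrier R" "\<And>s. w s \<in> carrier R" using assms by auto
  show ?thesis
    unfolding vec_dot_def using c by (simp add: r_distr finsum_addf Pi_def)
qed

lemma vec_dot_smult:
  assumes "finite S" "u \<in> UNIV \<rightarrow> carrier R" "v \<in> UNIV \<rightarrow> carrier R" "c \<in> carrier R"
  shows "vec_dot R S u (\<lambda>s. c \<otimes> v s) = c \<otimes> vec_dot R S u v"
proof -
  have c: "\<And>s. u s \<in> carrier R" "\<And>s. v s \<in> carrier R" using assms by auto
  show ?thesis
    unfolding vec_dot_def using c assms(1,4) by (simp add: m_lcomm finsum_rdistr Pi_def)
qed

lemma vec_dot_commute:
  assumes "u \<in> UNIV \<rightarrow> carrier R" "v \<in> UNIV \<rightarrow> carrier R"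
  shows "vec_dot R S u v = vec_dot R S v u"
proof -
  have c: "\<And>s. u s \<in> carrier R" "\<And>s. v s \<in> carrier R" using assms by auto
  show ?thesis
    unfolding vec_dot_def using c by (simp add: m_comm)
qed

lemma vec_dot_zero: "v \<in> UNIV \<rightarrow> carrier R \<Longrightarrow> vec_dot R S v (\<lambda>_. \<zero>) = \<zero>"
  unfolding vec_dot_def by (intro add.finprod_one_eqI) (auto simp: Pi_def)

lemma vec_dot_cong:
  assumes "v \<in> UNIV \<rightarrow> carrier R" "w \<in> UNIV \<rightarrow> carrier R" "\<And>s. s \<in> S \<Longrightarrow> u s = v s"
  shows "vec_dot R S u w = vec_dot R S v w"
  unfolding vec_dot_def using assms by (intro finsum_cong') auto

text \<open>This is how the Noetherian hypothesis reaches vectors: ideals of single coordinates are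
  finitely generated, and an induction on coordinates does the rest. Negatives come from the scalar
  -1, as \<open>vec_submodule\<close> does not list them.\<close>

lemma ideal_coordinate:
  assumes "vec_submodule R K"
  shows "ideal ((\<lambda>v. v s) ` K) R"
proof (rule idealI[OF ring_axioms])
  have K: "v t \<in> carrier R" if "v \<in> K" for v t
    using assms that by (auto simp: vec_submodule_def)
  show "subgroup ((\<lambda>v. v s) ` K) (add_monoid R)"
  proof (rule add.subgroupI)
    show "(\<lambda>v. v s) ` K \<subseteq> carrier R" using K by auto
    show "(\<lambda>v. v s) ` K \<noteq> {}" using assms by (auto simp: vec_submodule_def)
    show "\<ominus> a \<in> (\<lambda>v. v s) ` K" if a: "a \<in> (\<lambda>v. v s) ` K" for a
    proof -
      obtain v where v: "v \<in> K" "a = v s" using a by auto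
      then have "(\<lambda>t. \<ominus> \<one> \<otimes> v t) \<in> K"
        using assms by (simp add: vec_submodule_def)
      moreover have "\<ominus> a = \<ominus> \<one> \<otimes> v s" using v K by (simp add: l_minus)
      ultimately show ?thesis by (auto intro: rev_image_eqI)
    qed
    show "a \<oplus> b \<in> (\<lambda>v. v s) ` K" if ab: "a \<in> (\<lambda>v. v s) ` K" "b \<in> (\<lambda>v. v s) ` K" for a b
    proof -
      obtain v w where v: "v \<in> K" "a = v s" and w: "w \<in> K" "b = w s" using ab by auto
      then have "(\<lambda>t. v t \<oplus> w t) \<in> K"
        using assms by (simp add: vec_submodule_def)
      then show ?thesis using v w by (auto intro: rev_image_eqI)
    qed
  qed
  have smult: "x \<otimes> a \<in> (\<lambda>v. v s) ` K" if a: "a \<in> (\<lambda>v. v s) ` K" and x: "x \<in> carrier R" for a x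
  proof -
    obtain v where v: "v \<in> K" "a = v s" using a by auto
    then have "(\<lambda>t. x \<otimes> v t) \<in> K"
      using assms x by (simp add: vec_submodule_def)
    then show ?thesis using v by (auto intro: rev_image_eqI)
  qed
  then show "x \<otimes> a \<in> (\<lambda>v. v s) ` K" if "a \<in> (\<lambda>v. v s) ` K" and "x \<in> carrier R" for a x
    using that by simp
  show "a \<otimes> x \<in> (\<lambda>v. v s) ` K" if "a \<in> (\<lambda>v. v s) ` K" and "x \<in> carrier R" for a x
    using that smult[OF that] K by (auto simp: m_comm)
qed

end

text \<open>Finite generation of $K$ modulo the coordinates outside $S$, with the span of $B$ replaced by
  all submodules $L$ containing $B$.\<close>
lemma (in noetherian_ring) vec_submodule_finite_generation:
  assumes "cring R" "finite S" "vec_submodule R K"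
  shows "\<exists>B. finite B \<and> B \<subseteq> K \<and>
    (\<forall>L. vec_submodule R L \<and> B \<subseteq> L \<longrightarrow> (\<forall>v\<in>K. \<exists>w\<in>L. \<forall>s\<in>S. v s = w s))"
  using assms(2,3)
proof (induction S arbitrary: K)
  case empty
  show ?case by (rule exI[of _ "{}"]) (auto simp: vec_submodule_def)
next
  case (insert s S)
  interpret cring R by fact
  have K: "v t \<in> carrier R" if "v \<in> K" for v t
    using insert.prems that by (auto simp: vec_submodule_def)
  obtain A where A: "A \<subseteq> carrier R" "finite A" "(\<lambda>v. v s) ` K = Idl A"
    using finetely_gen[OF ideal_coordinate[OF insert.prems, of s]] by (elim exE conjE)
  then have "A \<subseteq> (\<lambda>v. v s) ` K" using genideal_self by simp
  then obtain B1 where B1: "B1 \<subseteq> K" "finite B1" "A = (\<lambda>v. v s) ` B1"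
    using finite_subset_image[OF A(2), of "\<lambda>v. v s" K] by blast
  \<comment> \<open>Lifts of generators of the coordinate ideal at \<open>s\<close> take care of
    that coordinate; what remains lies in its kernel, where only \<open>S\<close> matters.\<close>
  define K' where "K' = {v \<in> K. v s = \<zero>}"
  have "vec_submodule R K'"
    using insert.prems by (auto simp: vec_submodule_def K'_def)
  from insert.IH[OF this] obtain B2 where B2: "finite B2" "B2 \<subseteq> K'"
    and gen: "\<forall>L. vec_submodule R L \<and> B2 \<subseteq> L \<longrightarrow> (\<forall>v\<in>K'. \<exists>w\<in>L. \<forall>t\<in>S. v t = w t)"
    by (elim exE conjE)
  have "\<exists>w\<in>L. \<forall>t\<in>insert s S. v t = w t"
    if L0: "vec_submodule R L" "B1 \<union> B2 \<subseteq> L" and v: "v \<in> K" for L v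
  proof -
    \<comment> \<open>Taking \<open>w1\<close> from \<open>L \<inter> K\<close> keeps the difference
      of \<open>v\<close> and \<open>w1\<close> in \<open>K\<close>. Requiring
      \<open>w s = \<zero>\<close> ensures that the correction supplied by the induction hypothesis
      leaves the coordinate \<open>s\<close>, already matched by \<open>w1\<close>,
      untouched.\<close>
    define L' where "L' = {w \<in> L \<inter> K. w s = \<zero>}"
    have LK: "vec_submodule R (L \<inter> K)"
      using L0 insert.prems by (auto simp: vec_submodule_def)
    then have L': "vec_submodule R L'"
      by (auto simp: vec_submodule_def L'_def)
    have "A \<subseteq> (\<lambda>v. v s) ` (L \<inter> K)" using B1 L0 by auto
    then have "Idl A \<subseteq> (\<lambda>v. v s) ` (L \<inter> K)"
      by (rule genideal_minimal[OF ideal_coordinate[OF LK]])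
    then have "v s \<in> (\<lambda>v. v s) ` (L \<inter> K)" using v A by auto
    then obtain w1 where w1: "w1 \<in> L \<inter> K" "v s = w1 s" by auto
    define u where "u t = v t \<oplus> \<ominus> \<one> \<otimes> w1 t" for t
    have "(\<lambda>t. \<ominus> \<one> \<otimes> w1 t) \<in> K"
      using insert.prems w1 by (auto simp: vec_submodule_def)
    then have "u \<in> K"
      using insert.prems v unfolding u_def[abs_def] by (simp add: vec_submodule_def)
    moreover have "u s = \<zero>"
      using w1 K[OF v, of s] by (simp add: u_def l_minus r_neg)
    ultimately have u: "u \<in> K'" by (simp add: K'_def)
    have B2L: "B2 \<subseteq> L'" using B2 L0 by (auto simp: L'_def K'_def)
    obtain w2 where w2: "w2 \<in> L'" "\<forall>t\<in>S. u t = w2 t"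
      using gen[rule_format, OF conjI[OF L' B2L] u] by (elim bexE)
    define w where "w t = w1 t \<oplus> w2 t" for t
    have "w \<in> L"
      using LK w1 w2(1) L0 unfolding w_def[abs_def] L'_def by (auto simp: vec_submodule_def)
    moreover have "v t = w t" if t: "t \<in> insert s S" for t
    proof (cases "t = s")
      case True
      then show ?thesis using w1 w2 K by (simp add: w_def L'_def)
    next
      case False
      then have "w2 t = u t" using t w2 by simp
      moreover have "w1 t \<in> carrier R" "v t \<in> carrier R" using K v w1 by auto
      ultimately show ?thesis by (simp add: w_def u_def l_minus a_lcomm r_neg)
    qed
    ultimately show ?thesis by blast
  qed
  then show ?case
    using B1 B2 by (intro exI[of _ "B1 \<union> B2"]) (auto simp: K'_def)
qed

text \<open>The vectors orthogonal to a fixed \<open>v\<close> form a submodule, so orthogonality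
  spreads from generators of \<open>K\<close> to all of \<open>K\<close>. The set \<open>B\<close>
  does not depend on \<open>v\<close>; finite presentation enters the proof in this form.\<close>

lemma (in noetherian_ring) vec_orthogonal_finite:
  assumes "cring R" "finite S" "vec_submodule R K"
  shows "\<exists>B. finite B \<and> B \<subseteq> K \<and> (\<forall>v \<in> UNIV \<rightarrow> carrier R.
    (\<forall>k\<in>B. vec_dot R S k v = \<zero>) \<longrightarrow> (\<forall>k\<in>K. vec_dot R S k v = \<zero>))"
proof -
  interpret cring R by fact
  obtain B where B: "finite B" "B \<subseteq> K"
    and gen: "\<forall>L. vec_submodule R L \<and> B \<subseteq> L \<longrightarrow> (\<forall>v\<in>K. \<exists>w\<in>L. \<forall>s\<in>S. v s = w s)"
    using vec_submodule_finite_generation[OF assms] by (elim exE conjE)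
  have "vec_dot R S k v = \<zero>"
    if v: "v \<in> UNIV \<rightarrow> carrier R" and 0: "\<forall>k\<in>B. vec_dot R S k v = \<zero>" and k: "k \<in> K" for v k
  proof -
    define L where "L = {w \<in> UNIV \<rightarrow> carrier R. vec_dot R S v w = \<zero>}"
    have L: "vec_submodule R L"
      using v assms(2) by (auto simp: L_def vec_submodule_def vec_dot_add vec_dot_smult vec_dot_zero)
    have BL: "B \<subseteq> L"
    proof
      fix b assume b: "b \<in> B"
      then have "b \<in> UNIV \<rightarrow> carrier R" using B(2) assms(3) by (auto simp: vec_submodule_def)
      with b 0 vec_dot_commute[OF v this, of S] show "b \<in> L" by (simp add: L_def)
    qed
    obtain w where w: "w \<in> L" "\<forall>s\<in>S. k s = w s"
      using gen[rule_format, OF conjI[OF L BL] k] by (elim bexE)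
    then have "vec_dot R S k v = vec_dot R S w v"
      using v by (intro vec_dot_cong) (auto simp: L_def)
    also have "\<dots> = \<zero>" using w vec_dot_commute[of w v] v by (simp add: L_def)
    finally show ?thesis .
  qed
  then show ?thesis using B by blast
qed

section \<open>Linear systems with unknowns in an injective module\<close>

lemma (in module) finsum_smult_rdistr:
  assumes "finite A" "x \<in> carrier M" "f \<in> A \<rightarrow> carrier R"
  shows "(\<Oplus>\<^bsub>R\<^esub>i\<in>A. f i) \<odot>\<^bsub>M\<^esub> x = (\<Oplus>\<^bsub>M\<^esub>i\<in>A. f i \<odot>\<^bsub>M\<^esub> x)"
  using assms(1,3)
proof (induction A rule: finite_induct)
  case empty
  show ?case using assms(2) by simp
next
  case (insert a A)
  then show ?case using assms(2) by (simp add: smult_l_distr Pi_def)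
qed

text \<open>A compatibility criterion: the system is solvable if every combination of equations that
  cancels all unknowns also cancels the right-hand side \<open>w\<close>. Baer's criterion extends
  maps from ideals only, which suffices to determine one unknown at a time. The unknowns are indexed
  by their own coefficient vectors \<open>k\<close>.\<close>

lemma injective_module_linear_system:
  assumes E: "module R E" "injective_module R E"
    and S: "finite S" and J: "finite J"
    and "J \<subseteq> UNIV \<rightarrow> carrier R" and "w \<in> UNIV \<rightarrow> carrier E"
    and "\<And>v. v \<in> UNIV \<rightarrow> carrier R \<Longrightarrow> (\<forall>k\<in>J. vec_dot R S k v = \<zero>\<^bsub>R\<^esub>) \<Longrightarrow>
      (\<Oplus>\<^bsub>E\<^esub>s\<in>S. v s \<odot>\<^bsub>E\<^esub> w s) = \<zero>\<^bsub>E\<^esub>"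
  shows "\<exists>e \<in> UNIV \<rightarrow> carrier E. \<forall>s\<in>S. w s = (\<Oplus>\<^bsub>E\<^esub>k\<in>J. k s \<odot>\<^bsub>E\<^esub> e k)"
proof -
  interpret module R E by fact
  show ?thesis
    using J assms(5-)
  proof (induction J arbitrary: w)
    case empty
    have "w s = \<zero>\<^bsub>E\<^esub>" if s: "s \<in> S" for s
    proof -
      \<comment> \<open>With no unknowns every vector is admissible, and unit vectors read off the
        coordinates of \<open>w\<close>.\<close>
      define v where "v t = (if t = s then \<one>\<^bsub>R\<^esub> else \<zero>\<^bsub>R\<^esub>)" for t
      have w: "\<And>t. w t \<in> carrier E" using empty by auto
      have "(\<Oplus>\<^bsub>E\<^esub>t\<in>S. v t \<odot>\<^bsub>E\<^esub> w t) = \<zero>\<^bsub>E\<^esub>"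
        using empty by (auto simp: v_def)
      moreover have "(\<Oplus>\<^bsub>E\<^esub>t\<in>S. v t \<odot>\<^bsub>E\<^esub> w t) = (\<Oplus>\<^bsub>E\<^esub>t\<in>S. if s = t then w t else \<zero>\<^bsub>E\<^esub>)"
        using w by (intro M.finsum_cong') (auto simp: v_def)
      moreover have "\<dots> = w s"
        using M.finsum_singleton[OF s S] w by (simp add: Pi_def)
      ultimately show ?thesis by simp
    qed
    then show ?case by (intro bexI[of _ "\<lambda>_. \<zero>\<^bsub>E\<^esub>"]) auto
  next
    case (insert k J)
    have w: "\<And>s. w s \<in> carrier E" and k: "k \<in> UNIV \<rightarrow> carrier R" "\<And>s. k s \<in> carrier R"
      and J: "J \<subseteq> UNIV \<rightarrow> carrier R"
      using insert.prems by auto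
    \<comment> \<open>Combining the equations with weights from \<open>V\<close> eliminates every
      unknown except the one for \<open>k\<close>, whose coefficient becomes
      \<open>vec_dot R S k v\<close> and whose right-hand side becomes
      \<open>pair v\<close>.\<close>
    define V where "V = {v \<in> UNIV \<rightarrow> carrier R. \<forall>j\<in>J. vec_dot R S j v = \<zero>\<^bsub>R\<^esub>}"
    define pair where "pair v = (\<Oplus>\<^bsub>E\<^esub>s\<in>S. v s \<odot>\<^bsub>E\<^esub> w s)" for v
    have V: "vec_submodule R V"
    proof -
      have "j \<in> UNIV \<rightarrow> carrier R" if "j \<in> J" for j using J that by auto
      then show ?thesis
        using S by (auto simp: V_def vec_submodule_def R.vec_dot_add R.vec_dot_smult R.vec_dot_zero)
    qed
    have VD: "v \<in> UNIV \<rightarrow> carrier R" "\<And>s. v s \<in> carrier R" if "v \<in> V" for v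
      using that by (auto simp: V_def)
    have pair_closed: "pair v \<in> carrier E" if "v \<in> V" for v
      unfolding pair_def using VD[OF that] w by (intro M.finsum_closed) auto
    have pair_add: "pair (\<lambda>s. u s \<oplus>\<^bsub>R\<^esub> v s) = pair u \<oplus>\<^bsub>E\<^esub> pair v" if "u \<in> V" "v \<in> V" for u v
      unfolding pair_def using VD that w by (simp add: smult_l_distr M.finsum_addf Pi_def)
    have pair_smult: "pair (\<lambda>s. c \<otimes>\<^bsub>R\<^esub> v s) = c \<odot>\<^bsub>E\<^esub> pair v" if "v \<in> V" "c \<in> carrier R" for v c
      unfolding pair_def using VD that w S by (simp add: smult_assoc1 finsum_smult_ldistr Pi_def)
    \<comment> \<open>Such a vector is orthogonal to all of \<open>insert k J\<close>, so the
      hypothesis on \<open>w\<close> applies. Hence \<open>pair v\<close> depends only on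
      \<open>vec_dot R S k v\<close>.\<close>
    have pair_zero: "pair v = \<zero>\<^bsub>E\<^esub>" if "v \<in> V" "vec_dot R S k v = \<zero>\<^bsub>R\<^esub>" for v
      using insert.prems(3)[of v] that unfolding pair_def V_def by auto
    have pair_unique: "pair u = pair v" if uv: "u \<in> V" "v \<in> V" "vec_dot R S k u = vec_dot R S k v" for u v
    proof -
      define n where "n = (\<lambda>s. (\<ominus>\<^bsub>R\<^esub> \<one>\<^bsub>R\<^esub>) \<otimes>\<^bsub>R\<^esub> v s)"
      have n: "n \<in> V" using V uv(2) by (simp add: vec_submodule_def n_def)
      let ?d = "\<lambda>s. u s \<oplus>\<^bsub>R\<^esub> n s"
      have d: "?d \<in> V" using V uv(1) n by (simp add: vec_submodule_def)
      have "vec_dot R S k ?d = vec_dot R S k u \<oplus>\<^bsub>R\<^esub> vec_dot R S k n"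
        using uv n k VD by (intro R.vec_dot_add) auto
      also have "vec_dot R S k n = (\<ominus>\<^bsub>R\<^esub> \<one>\<^bsub>R\<^esub>) \<otimes>\<^bsub>R\<^esub> vec_dot R S k v"
        unfolding n_def using uv k VD S by (intro R.vec_dot_smult) auto
      finally have "vec_dot R S k ?d = \<zero>\<^bsub>R\<^esub>"
        using uv k(1) VD(1) by (simp add: R.l_minus R.r_neg)
      then have "pair ?d = \<zero>\<^bsub>E\<^esub>" using d pair_zero by blast
      moreover have "pair ?d = pair u \<oplus>\<^bsub>E\<^esub> (\<ominus>\<^bsub>R\<^esub> \<one>\<^bsub>R\<^esub>) \<odot>\<^bsub>E\<^esub> pair v"
        using uv n pair_add pair_smult[OF uv(2), of "\<ominus>\<^bsub>R\<^esub> \<one>\<^bsub>R\<^esub>"] by (simp add: n_def)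
      ultimately have "pair u \<oplus>\<^bsub>E\<^esub> \<ominus>\<^bsub>E\<^esub> pair v = \<zero>\<^bsub>E\<^esub>"
        using pair_closed uv by (simp add: smult_l_minus)
      then show ?thesis
        using M.minus_equality[of "pair u" "\<ominus>\<^bsub>E\<^esub> pair v"] pair_closed uv by simp
    qed
    \<comment> \<open>The eliminated equations prescribe a linear map on the ideal of all
      coefficients; an element representing it by Baer's criterion satisfies all of them at
      once.\<close>
    define I where "I = vec_dot R S k ` V"
    define g where "g r = pair (SOME v. v \<in> V \<and> vec_dot R S k v = r)" for r
    have g: "g (vec_dot R S k v) = pair v" if v: "v \<in> V" for v
    proof -
      have "\<exists>u. u \<in> V \<and> vec_dot R S k u = vec_dot R S k v" using v by blast
      from someI_ex[OF this] show ?thesis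
        unfolding g_def using v by (intro pair_unique) auto
    qed
    have dot_add: "vec_dot R S k (\<lambda>s. u s \<oplus>\<^bsub>R\<^esub> v s) = vec_dot R S k u \<oplus>\<^bsub>R\<^esub> vec_dot R S k v"
      if "u \<in> V" "v \<in> V" for u v using that k VD by (intro R.vec_dot_add) auto
    have dot_smult: "vec_dot R S k (\<lambda>s. c \<otimes>\<^bsub>R\<^esub> v s) = c \<otimes>\<^bsub>R\<^esub> vec_dot R S k v"
      if "v \<in> V" "c \<in> carrier R" for v c using that k VD S by (intro R.vec_dot_smult) auto
    have Vadd: "(\<lambda>s. u s \<oplus>\<^bsub>R\<^esub> v s) \<in> V" if "u \<in> V" "v \<in> V" for u v
      using V that by (simp add: vec_submodule_def)
    have Vsmult: "(\<lambda>s. c \<otimes>\<^bsub>R\<^esub> v s) \<in> V" if "v \<in> V" "c \<in> carrier R" for v c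
      using V that by (simp add: vec_submodule_def)
    have "ideal I R"
    proof (rule idealI[OF R.ring_axioms])
      have smult: "c \<otimes>\<^bsub>R\<^esub> a \<in> I" if "a \<in> I" "c \<in> carrier R" for a c
        using that Vsmult by (force simp: I_def simp flip: dot_smult)
      have sub: "I \<subseteq> carrier R" using k(1) VD(1) by (auto simp: I_def)
      show "subgroup I (add_monoid R)"
      proof (rule R.add.subgroupI)
        show "I \<subseteq> carrier R" by (rule sub)
        show "I \<noteq> {}" using V by (auto simp: vec_submodule_def I_def)
        show "\<ominus>\<^bsub>R\<^esub> a \<in> I" if "a \<in> I" for a
          using smult[OF that, of "\<ominus>\<^bsub>R\<^esub> \<one>\<^bsub>R\<^esub>"] sub that by (simp add: R.l_minus subset_iff)
        show "a \<oplus>\<^bsub>R\<^esub> b \<in> I" if "a \<in> I" "b \<in> I" for a b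
          using that Vadd by (force simp: I_def simp flip: dot_add)
      qed
      show "c \<otimes>\<^bsub>R\<^esub> a \<in> I" if "a \<in> I" "c \<in> carrier R" for a c
        by (rule smult[OF that])
      show "a \<otimes>\<^bsub>R\<^esub> c \<in> I" if "a \<in> I" "c \<in> carrier R" for a c
        using smult[OF that] sub that R.m_comm[of a c] by auto
    qed
    moreover have "lin_on_ideal R E I g"
      unfolding lin_on_ideal_def I_def
      by (auto simp: g pair_closed pair_add pair_smult Vadd Vsmult simp flip: dot_add dot_smult)
    ultimately obtain e where e: "e \<in> carrier E" "\<And>r. r \<in> I \<Longrightarrow> g r = r \<odot>\<^bsub>E\<^esub> e"
      using E(2) unfolding injective_module_def by meson
    \<comment> \<open>Substituting the value found for the unknown of \<open>k\<close> leaves a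
      system in the unknowns of \<open>J\<close>. It is compatible because \<open>e\<close> was
      chosen to satisfy every eliminated equation.\<close>
    define w' where "w' s = w s \<ominus>\<^bsub>E\<^esub> k s \<odot>\<^bsub>E\<^esub> e" for s
    have "\<exists>f \<in> UNIV \<rightarrow> carrier E. \<forall>s\<in>S. w' s = (\<Oplus>\<^bsub>E\<^esub>k\<in>J. k s \<odot>\<^bsub>E\<^esub> f k)"
    proof (rule insert.IH)
      show "J \<subseteq> UNIV \<rightarrow> carrier R" by fact
      show "w' \<in> UNIV \<rightarrow> carrier E" using w k e by (simp add: w'_def)
      fix v assume "v \<in> UNIV \<rightarrow> carrier R" "\<forall>k\<in>J. vec_dot R S k v = \<zero>\<^bsub>R\<^esub>"
      then have v: "v \<in> V" by (simp add: V_def)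
      have "(\<Oplus>\<^bsub>E\<^esub>s\<in>S. v s \<odot>\<^bsub>E\<^esub> w' s) =
        (\<Oplus>\<^bsub>E\<^esub>s\<in>S. v s \<odot>\<^bsub>E\<^esub> w s \<oplus>\<^bsub>E\<^esub> (k s \<otimes>\<^bsub>R\<^esub> v s) \<odot>\<^bsub>E\<^esub> (\<ominus>\<^bsub>E\<^esub> e))"
        using VD[OF v] w k e
        by (intro M.finsum_cong') (auto simp: w'_def M.minus_eq smult_r_distr smult_r_minus smult_assoc1 R.m_comm[of "k _"])
      also have "\<dots> = pair v \<oplus>\<^bsub>E\<^esub> (\<Oplus>\<^bsub>E\<^esub>s\<in>S. (k s \<otimes>\<^bsub>R\<^esub> v s) \<odot>\<^bsub>E\<^esub> (\<ominus>\<^bsub>E\<^esub> e))"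
        unfolding pair_def using VD[OF v] w k e by (intro M.finsum_addf) auto
      also have "(\<Oplus>\<^bsub>E\<^esub>s\<in>S. (k s \<otimes>\<^bsub>R\<^esub> v s) \<odot>\<^bsub>E\<^esub> (\<ominus>\<^bsub>E\<^esub> e)) = vec_dot R S k v \<odot>\<^bsub>E\<^esub> (\<ominus>\<^bsub>E\<^esub> e)"
        unfolding vec_dot_def using VD[OF v] k e by (intro finsum_smult_rdistr[symmetric] S) auto
      also have "\<dots> = \<ominus>\<^bsub>E\<^esub> pair v"
        using e(2)[of "vec_dot R S k v"] e(1) v g[OF v] k(1) VD(1)[OF v] by (simp add: I_def smult_r_minus)
      finally show "(\<Oplus>\<^bsub>E\<^esub>s\<in>S. v s \<odot>\<^bsub>E\<^esub> w' s) = \<zero>\<^bsub>E\<^esub>"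
        using pair_closed[OF v] by (simp add: M.r_neg)
    qed
    then obtain f where f: "f \<in> UNIV \<rightarrow> carrier E" "\<forall>s\<in>S. w' s = (\<Oplus>\<^bsub>E\<^esub>k\<in>J. k s \<odot>\<^bsub>E\<^esub> f k)" by blast
    have "w s = (\<Oplus>\<^bsub>E\<^esub>j\<in>insert k J. j s \<odot>\<^bsub>E\<^esub> (f(k := e)) j)" if s: "s \<in> S" for s
    proof -
      have js: "j s \<in> carrier R" if "j \<in> J" for j using J that by auto
      have fc: "f j \<in> carrier E" for j using f by auto
      have "(\<Oplus>\<^bsub>E\<^esub>j\<in>insert k J. j s \<odot>\<^bsub>E\<^esub> (f(k := e)) j) =
        k s \<odot>\<^bsub>E\<^esub> e \<oplus>\<^bsub>E\<^esub> (\<Oplus>\<^bsub>E\<^esub>j\<in>J. j s \<odot>\<^bsub>E\<^esub> (f(k := e)) j)"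
        using insert.hyps js fc k e by (subst M.finsum_insert) auto
      also have "(\<Oplus>\<^bsub>E\<^esub>j\<in>J. j s \<odot>\<^bsub>E\<^esub> (f(k := e)) j) = (\<Oplus>\<^bsub>E\<^esub>j\<in>J. j s \<odot>\<^bsub>E\<^esub> f j)"
        using insert.hyps js fc by (intro M.finsum_cong') auto
      also have "\<dots> = w s \<ominus>\<^bsub>E\<^esub> k s \<odot>\<^bsub>E\<^esub> e" using f(2) s by (auto simp: w'_def)
      finally show ?thesis
        using w[of s] k e by (simp add: M.minus_eq M.a_lcomm M.r_neg)
    qed
    moreover have "f(k := e) \<in> UNIV \<rightarrow> carrier E" using f e by auto
    ultimately show ?case by blast
  qed
qed

section \<open>Finiteness of iterated Frobenius\<close>

text \<open>Generators of $R$ over its subring of $p^k$-th powers: if $S$ works for $p$ and $T$ for $p^k$,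
  then the products $s t^p$ work for $p^{k+1}$.\<close>
lemma F_finite_power:
  assumes "cring R" and p: "Factorial_Ring.prime p" and char: "[p] \<cdot>\<^bsub>R\<^esub> \<one>\<^bsub>R\<^esub> = \<zero>\<^bsub>R\<^esub>"
    and fin: "F_finite R p"
  shows "F_finite R (p ^ k)"
proof -
  interpret cring R by fact
  note dream = freshmans_dream_power[OF p char]
  note dream1 = freshmans_dream[OF p char]
  have p0: "0 < p" using p by (simp add: prime_gt_0_nat)
  \<comment> \<open>Generation is phrased through closed sets \<open>H\<close> instead of
    coefficients. This avoids double sums over products s t^p, which need not be distinct for
    distinct pairs.\<close>
  have gen: "\<exists>S. finite S \<and> S \<subseteq> carrier R \<and> (\<forall>H. \<zero>\<^bsub>R\<^esub> \<in> H \<and> S \<subseteq> H \<and> H \<subseteq> carrier R \<and>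
      (\<forall>x\<in>H. \<forall>y\<in>H. x \<oplus>\<^bsub>R\<^esub> y \<in> H) \<and> (\<forall>x\<in>H. \<forall>c\<in>carrier R. x \<otimes>\<^bsub>R\<^esub> c [^]\<^bsub>R\<^esub> (p ^ k) \<in> H)
      \<longrightarrow> H = carrier R)"
  proof (induction k)
    case 0
    show ?case
    proof (intro exI[of _ "{\<one>\<^bsub>R\<^esub>}"] conjI allI impI)
      fix H assume H: "\<zero>\<^bsub>R\<^esub> \<in> H \<and> {\<one>\<^bsub>R\<^esub>} \<subseteq> H \<and> H \<subseteq> carrier R \<and>
        (\<forall>x\<in>H. \<forall>y\<in>H. x \<oplus>\<^bsub>R\<^esub> y \<in> H) \<and> (\<forall>x\<in>H. \<forall>c\<in>carrier R. x \<otimes>\<^bsub>R\<^esub> c [^]\<^bsub>R\<^esub> (p ^ 0) \<in> H)"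
      then have "\<one>\<^bsub>R\<^esub> \<otimes>\<^bsub>R\<^esub> c [^]\<^bsub>R\<^esub> (p ^ 0) \<in> H" if "c \<in> carrier R" for c
        using that by blast
      then show "H = carrier R" using H by auto
    qed auto
  next
    case (Suc k)
    obtain S where S: "finite S" "S \<subseteq> carrier R"
      "\<forall>r \<in> carrier R. \<exists>c. c \<in> S \<rightarrow> carrier R \<and>
            r = (\<Oplus>\<^bsub>R\<^esub> s \<in> S. s \<otimes>\<^bsub>R\<^esub> (c s [^]\<^bsub>R\<^esub> p))"
      using fin unfolding F_finite_def by (elim exE conjE)
    obtain T where T: "finite T" "T \<subseteq> carrier R" "\<forall>H. \<zero>\<^bsub>R\<^esub> \<in> H \<and> T \<subseteq> H \<and> H \<subseteq> carrier R \<and>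
      (\<forall>x\<in>H. \<forall>y\<in>H. x \<oplus>\<^bsub>R\<^esub> y \<in> H) \<and> (\<forall>x\<in>H. \<forall>c\<in>carrier R. x \<otimes>\<^bsub>R\<^esub> c [^]\<^bsub>R\<^esub> (p ^ k) \<in> H)
      \<longrightarrow> H = carrier R"
      using Suc.IH by (elim exE conjE)
    let ?U = "(\<lambda>(s, t). s \<otimes>\<^bsub>R\<^esub> t [^]\<^bsub>R\<^esub> p) ` (S \<times> T)"
    show ?case
    proof (intro exI[of _ ?U] conjI allI impI)
      show "finite ?U" using S(1,2) T(1,2) by simp
      show "?U \<subseteq> carrier R" using S(1,2) T(1,2) by auto
      fix H assume *: "\<zero>\<^bsub>R\<^esub> \<in> H \<and> ?U \<subseteq> H \<and> H \<subseteq> carrier R \<and>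
        (\<forall>x\<in>H. \<forall>y\<in>H. x \<oplus>\<^bsub>R\<^esub> y \<in> H) \<and> (\<forall>x\<in>H. \<forall>c\<in>carrier R. x \<otimes>\<^bsub>R\<^esub> c [^]\<^bsub>R\<^esub> (p ^ Suc k) \<in> H)"
      then have H0: "\<zero>\<^bsub>R\<^esub> \<in> H" and HU: "\<And>s t. s \<in> S \<Longrightarrow> t \<in> T \<Longrightarrow> s \<otimes>\<^bsub>R\<^esub> t [^]\<^bsub>R\<^esub> p \<in> H"
        and HR: "H \<subseteq> carrier R" and Hadd: "\<And>x y. x \<in> H \<Longrightarrow> y \<in> H \<Longrightarrow> x \<oplus>\<^bsub>R\<^esub> y \<in> H"
        and Hmult: "\<And>x c. x \<in> H \<Longrightarrow> c \<in> carrier R \<Longrightarrow> x \<otimes>\<^bsub>R\<^esub> c [^]\<^bsub>R\<^esub> (p ^ Suc k) \<in> H"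
        by auto
      have sy: "s \<otimes>\<^bsub>R\<^esub> y [^]\<^bsub>R\<^esub> p \<in> H" if s: "s \<in> S" and y: "y \<in> carrier R" for s y
      proof -
        have sR: "s \<in> carrier R" using s S(1,2) by auto
        \<comment> \<open>Since (x c^(p^k))^p = x^p c^(p^(k+1)), closure of \<open>H\<close> at
          level k + 1 gives closure of \<open>G\<close> at level k, so the induction hypothesis
          applies to \<open>G\<close>.\<close>
        define G where "G = {y \<in> carrier R. s \<otimes>\<^bsub>R\<^esub> y [^]\<^bsub>R\<^esub> p \<in> H}"
        have "\<zero>\<^bsub>R\<^esub> \<in> G" using H0 sR p0 by (simp add: G_def nat_pow_zero)
        moreover have "T \<subseteq> G" using T(2) HU[OF s] by (auto simp: G_def)
        moreover have "x \<oplus>\<^bsub>R\<^esub> y \<in> G" if "x \<in> G" "y \<in> G" for x y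
          using that sR Hadd by (simp add: G_def dream1 r_distr)
        moreover have "x \<otimes>\<^bsub>R\<^esub> c [^]\<^bsub>R\<^esub> (p ^ k) \<in> G" if "x \<in> G" "c \<in> carrier R" for x c
        proof -
          have "s \<otimes>\<^bsub>R\<^esub> x [^]\<^bsub>R\<^esub> p \<otimes>\<^bsub>R\<^esub> c [^]\<^bsub>R\<^esub> (p ^ Suc k) \<in> H"
            using that Hmult by (simp add: G_def)
          then show ?thesis
            using that sR by (simp add: G_def nat_pow_distrib nat_pow_pow m_assoc mult.commute)
        qed
        ultimately have "G = carrier R" using T(3) by (auto simp: G_def)
        then show ?thesis using y by (auto simp: G_def)
      qed
      have "r \<in> H" if "r \<in> carrier R" for r
      proof -
        obtain c where c: "c \<in> S \<rightarrow> carrier R" "r = (\<Oplus>\<^bsub>R\<^esub> s \<in> S. s \<otimes>\<^bsub>R\<^esub> (c s [^]\<^bsub>R\<^esub> p))"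
          using bspec[OF S(3) \<open>r \<in> carrier R\<close>] by (elim exE conjE)
        have "(\<Oplus>\<^bsub>R\<^esub> s \<in> S'. s \<otimes>\<^bsub>R\<^esub> (c s [^]\<^bsub>R\<^esub> p)) \<in> H" if "S' \<subseteq> S" for S'
          using finite_subset[OF that S(1)] that
        proof (induction S' rule: finite_induct)
          case empty
          then show ?case using H0 by simp
        next
          case (insert s S')
          then have "s \<otimes>\<^bsub>R\<^esub> (c s [^]\<^bsub>R\<^esub> p) \<in> H" using c sy by auto
          moreover have "(\<Oplus>\<^bsub>R\<^esub> s \<in> S'. s \<otimes>\<^bsub>R\<^esub> (c s [^]\<^bsub>R\<^esub> p)) \<in> H" using insert by auto
          moreover have "x \<otimes>\<^bsub>R\<^esub> (c x [^]\<^bsub>R\<^esub> p) \<in> carrier R" if "x \<in> insert s S'" for x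
            using that insert.prems c(1) S(2) by (auto simp: Pi_def subset_iff)
          ultimately show ?case
            using insert.hyps Hadd by (subst finsum_insert) auto
        qed
        then show ?thesis using c by blast
      qed
      then show "H = carrier R" using HR by auto
    qed
  qed
  then obtain S where S: "finite S" "S \<subseteq> carrier R" "\<forall>H. \<zero>\<^bsub>R\<^esub> \<in> H \<and> S \<subseteq> H \<and> H \<subseteq> carrier R \<and>
      (\<forall>x\<in>H. \<forall>y\<in>H. x \<oplus>\<^bsub>R\<^esub> y \<in> H) \<and> (\<forall>x\<in>H. \<forall>c\<in>carrier R. x \<otimes>\<^bsub>R\<^esub> c [^]\<^bsub>R\<^esub> (p ^ k) \<in> H)
      \<longrightarrow> H = carrier R"
    by (elim exE conjE)
  have q0: "0 < p ^ k" using p0 by simp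
  define comb where "comb c = (\<Oplus>\<^bsub>R\<^esub> s \<in> S. s \<otimes>\<^bsub>R\<^esub> (c s [^]\<^bsub>R\<^esub> (p ^ k)))" for c
  have summand: "s \<otimes>\<^bsub>R\<^esub> (c s [^]\<^bsub>R\<^esub> (p ^ k)) \<in> carrier R" if "c \<in> S \<rightarrow> carrier R" "s \<in> S" for c s
    using that S(1,2) by auto
  have comb_closed: "comb c \<in> carrier R" if "c \<in> S \<rightarrow> carrier R" for c
    unfolding comb_def using summand[OF that] by (intro finsum_closed) auto
  \<comment> \<open>The set of explicit combinations is itself closed, which turns the closure form
    of generation back into coefficients.\<close>
  let ?H = "comb ` (S \<rightarrow> carrier R)"
  have "\<zero>\<^bsub>R\<^esub> \<in> ?H"
  proof
    show "\<zero>\<^bsub>R\<^esub> = comb (\<lambda>_. \<zero>\<^bsub>R\<^esub>)"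
      unfolding comb_def using S(1,2) q0 by (intro add.finprod_one_eqI[symmetric]) (auto simp: nat_pow_zero)
  qed auto
  moreover have "S \<subseteq> ?H"
  proof
    fix s assume s: "s \<in> S"
    let ?c = "\<lambda>t. if s = t then \<one>\<^bsub>R\<^esub> else \<zero>\<^bsub>R\<^esub>"
    have "comb ?c = (\<Oplus>\<^bsub>R\<^esub>t\<in>S. if s = t then t else \<zero>\<^bsub>R\<^esub>)"
      unfolding comb_def using S(1,2) q0 by (intro finsum_cong') (auto simp: nat_pow_zero)
    also have "\<dots> = s" using finsum_singleton[OF s S(1), of "\<lambda>t. t"] S(1,2) by auto
    finally have "s = comb ?c" ..
    then show "s \<in> ?H" by (rule image_eqI[where f = comb]) auto
  qed
  moreover have "?H \<subseteq> carrier R" using comb_closed by auto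
  moreover have "x \<oplus>\<^bsub>R\<^esub> y \<in> ?H" if "x \<in> ?H" "y \<in> ?H" for x y
  proof -
    obtain c where c: "c \<in> S \<rightarrow> carrier R" "x = comb c"
      using \<open>x \<in> ?H\<close> by (rule imageE)
    obtain d where d: "d \<in> S \<rightarrow> carrier R" "y = comb d"
      using \<open>y \<in> ?H\<close> by (rule imageE)
    have "comb (\<lambda>s. c s \<oplus>\<^bsub>R\<^esub> d s) = (\<Oplus>\<^bsub>R\<^esub>s\<in>S. s \<otimes>\<^bsub>R\<^esub> (c s [^]\<^bsub>R\<^esub> (p ^ k)) \<oplus>\<^bsub>R\<^esub> s \<otimes>\<^bsub>R\<^esub> (d s [^]\<^bsub>R\<^esub> (p ^ k)))"
      unfolding comb_def using c d S(1,2)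
      by (intro finsum_cong') (auto simp: dream r_distr Pi_def subset_iff)
    also have "\<dots> = comb c \<oplus>\<^bsub>R\<^esub> comb d"
      unfolding comb_def using c d summand by (intro finsum_addf) auto
    finally have "x \<oplus>\<^bsub>R\<^esub> y = comb (\<lambda>s. c s \<oplus>\<^bsub>R\<^esub> d s)" using c d by simp
    then show ?thesis by (rule image_eqI[where f = comb]) (use c d in auto)
  qed
  moreover have "x \<otimes>\<^bsub>R\<^esub> b [^]\<^bsub>R\<^esub> (p ^ k) \<in> ?H" if "x \<in> ?H" "b \<in> carrier R" for x b
  proof -
    obtain c where c: "c \<in> S \<rightarrow> carrier R" "x = comb c"
      using \<open>x \<in> ?H\<close> by (rule imageE)
    have "comb (\<lambda>s. c s \<otimes>\<^bsub>R\<^esub> b) = (\<Oplus>\<^bsub>R\<^esub>s\<in>S. s \<otimes>\<^bsub>R\<^esub> (c s [^]\<^bsub>R\<^esub> (p ^ k)) \<otimes>\<^bsub>R\<^esub> b [^]\<^bsub>R\<^esub> (p ^ k))"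
      unfolding comb_def using c that S(1,2)
      by (intro finsum_cong') (auto simp: nat_pow_distrib m_assoc Pi_def subset_iff)
    also have "\<dots> = comb c \<otimes>\<^bsub>R\<^esub> b [^]\<^bsub>R\<^esub> (p ^ k)"
      unfolding comb_def using c that summand S(1,2) by (intro finsum_ldistr[symmetric]) auto
    finally have "x \<otimes>\<^bsub>R\<^esub> b [^]\<^bsub>R\<^esub> (p ^ k) = comb (\<lambda>s. c s \<otimes>\<^bsub>R\<^esub> b)" using c by simp
    then show ?thesis by (rule image_eqI[where f = comb]) (use c that in auto)
  qed
  ultimately have H: "?H = carrier R"
    by (intro S(3)[rule_format] conjI ballI) auto
  have "\<exists>c. c \<in> S \<rightarrow> carrier R \<and> r = comb c" if "r \<in> carrier R" for r
  proof -
    have "r \<in> ?H" using that by (simp only: H)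
    then show ?thesis by (rule imageE) blast
  qed
  then show ?thesis
    unfolding F_finite_def using S(1,2) by (intro exI[of _ S] conjI ballI) (auto simp: comb_def)
qed

section \<open>Tensor products and linear forms on iterated Frobenius\<close>

text \<open>For finitely supported \<open>y\<close> this is the additive extension of a map of basis
  elements to the free abelian groups. Both the action of a monomial and the descent map have this
  form.\<close>

definition pushforward :: "('k \<Rightarrow> 'l) \<Rightarrow> ('k \<Rightarrow> int) \<Rightarrow> 'l \<Rightarrow> int" where
  "pushforward h y = (\<lambda>l. \<Sum>k | y k \<noteq> 0 \<and> h k = l. y k)"

lemma pushforward_superset:
  assumes "finite A" "{k. y k \<noteq> 0} \<subseteq> A"
  shows "pushforward h y l = (\<Sum>k \<in> {k \<in> A. h k = l}. y k)"
  unfolding pushforward_def using assms by (intro sum.mono_neutral_left) auto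

lemma pushforward_zero: "pushforward h (\<lambda>_. 0) = (\<lambda>_. 0)"
  by (simp add: pushforward_def)

lemma pushforward_gen: "pushforward h (gen k) = gen (h k)"
proof
  fix l
  have "pushforward h (gen k) l = (\<Sum>j \<in> {j \<in> {k}. h j = l}. gen k j)"
    by (intro pushforward_superset) (auto simp: gen_def)
  also have "{j \<in> {k}. h j = l} = (if h k = l then {k} else {})" by auto
  finally show "pushforward h (gen k) l = gen (h k) l" by (auto simp: gen_def)
qed

lemma pushforward_fadd:
  assumes "finite {k. y k \<noteq> 0}" "finite {k. z k \<noteq> 0}"
  shows "pushforward h (fadd y z) = fadd (pushforward h y) (pushforward h z)"
proof
  fix l
  let ?A = "{k. y k \<noteq> 0} \<union> {k. z k \<noteq> 0}"
  have A: "finite ?A" using assms by simp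
  have "{k. y k \<noteq> 0} \<subseteq> ?A" "{k. z k \<noteq> 0} \<subseteq> ?A" "{k. fadd y z k \<noteq> 0} \<subseteq> ?A"
    by (auto simp: fadd_def)
  note sup = this[THEN pushforward_superset[OF A]]
  show "pushforward h (fadd y z) l = fadd (pushforward h y) (pushforward h z) l"
    unfolding fadd_def sup(1,2) sup(3)[unfolded fadd_def] by (rule sum.distrib)
qed

lemma pushforward_fneg: "pushforward h (fneg y) = fneg (pushforward h y)"
  by (auto simp: pushforward_def fneg_def sum_negf)

lemma finite_support_gen: "finite {j. gen k j \<noteq> 0}"
  by (rule finite_subset[of _ "{k}"]) (simp_all add: gen_def subset_iff)

lemma finite_support_fadd:
  assumes "finite {k. y k \<noteq> 0}" "finite {k. z k \<noteq> 0}"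
  shows "finite {k. fadd y z k \<noteq> 0}"
proof (rule finite_subset)
  show "{k. fadd y z k \<noteq> 0} \<subseteq> {k. y k \<noteq> 0} \<union> {k. z k \<noteq> 0}"
    by (auto simp: fadd_def)
  show "finite ({k. y k \<noteq> 0} \<union> {k. z k \<noteq> 0})" using assms by (rule finite_UnI)
qed

lemma finite_support_fneg: "finite {k. y k \<noteq> 0} \<Longrightarrow> finite {k. fneg y k \<noteq> 0}"
  by (simp add: fneg_def)

lemma fsub_eq_fadd_fneg: "fsub y z = fadd y (fneg z)"
  by (simp add: fsub_def fadd_def fneg_def)

lemmas finite_support = finite_support_gen finite_support_fadd finite_support_fneg

lemma finite_support_tens_rel: "y \<in> tens_rel R M q \<Longrightarrow> finite {k. y k \<noteq> 0}"
  by (induction rule: tens_rel.induct) (auto simp: fsub_eq_fadd_fneg intro!: finite_support)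

text \<open>Each fibre of the composite is grouped by its intermediate value. Finite support is what
  permits the regrouping.\<close>

lemma pushforward_compose:
  assumes "finite {k. y k \<noteq> 0}"
  shows "pushforward g (pushforward h y) = pushforward (g \<circ> h) y"
proof
  fix m
  let ?A = "{k. y k \<noteq> 0}"
  have "pushforward h y l = 0" if "l \<notin> h ` ?A" for l
    using that unfolding pushforward_def by (intro sum.neutral) auto
  then have "pushforward g (pushforward h y) m = (\<Sum>l \<in> {l \<in> h ` ?A. g l = m}. pushforward h y l)"
    using assms by (intro pushforward_superset) auto
  also have "\<dots> = (\<Sum>l \<in> {l \<in> h ` ?A. g l = m}. sum y {k \<in> {k \<in> ?A. g (h k) = m}. h k = l})"
    unfolding pushforward_def by (intro sum.cong arg_cong[of _ _ "sum y"]) auto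
  also have "\<dots> = sum y {k \<in> ?A. g (h k) = m}"
    using assms by (intro sum.group) auto
  also have "\<dots> = pushforward (g \<circ> h) y m"
    by (simp add: pushforward_def)
  finally show "pushforward g (pushforward h y) m = pushforward (g \<circ> h) y m" .
qed

lemma pushforward_cong:
  "(\<And>k. y k \<noteq> 0 \<Longrightarrow> h k = h' k) \<Longrightarrow> pushforward h y = pushforward h' y"
  unfolding pushforward_def by (intro ext sum.cong) auto

text \<open>In this form, composites of actions and descent can be compared on single generators.
  Both sums run over the same fibre, since the module component is left fixed.\<close>

lemma phi_act_eq_pushforward:
  "phi_act R p c k y = pushforward (\<lambda>(n, r, e). (k + n, c \<otimes>\<^bsub>R\<^esub> (r [^]\<^bsub>R\<^esub> (p ^ k)), e)) y"
proof (intro ext, clarify)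
  fix j s e
  show "phi_act R p c k y (j, s, e) =
    pushforward (\<lambda>(n, r, e). (k + n, c \<otimes>\<^bsub>R\<^esub> (r [^]\<^bsub>R\<^esub> (p ^ k)), e)) y (j, s, e)"
    unfolding phi_act_def pushforward_def prod.case
    by (rule sum.reindex_bij_witness[of _ "\<lambda>(n, r, e). (n, r)" "\<lambda>(n, r). (n, r, e)"]) auto
qed

section \<open>Congruences of formal sums modulo the tensor relations\<close>

lemma fsub_eq_minus: "fsub y z = y - z"
  by (simp add: fsub_def fun_eq_iff)

lemma tens_rel_add: "y \<in> tens_rel R M q \<Longrightarrow> z \<in> tens_rel R M q \<Longrightarrow> y + z \<in> tens_rel R M q"
  using tens_rel.plus[of y R M q z] by (simp add: fadd_def plus_fun_def)

lemma tens_rel_uminus: "y \<in> tens_rel R M q \<Longrightarrow> - y \<in> tens_rel R M q"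
  using tens_rel.uminus[of y R M q] by (simp add: fneg_def fun_Compl_def)

lemma tens_rel_zero: "0 \<in> tens_rel R M q"
  using tens_rel.zero[of R M q] by (simp add: zero_fun_def)

lemma tens_rel_trans:
  "x - y \<in> tens_rel R M q \<Longrightarrow> y - z \<in> tens_rel R M q \<Longrightarrow> x - z \<in> tens_rel R M q"
  using tens_rel_add[of "x - y" R M q "y - z"] by simp

lemma tens_rel_sym: "x - y \<in> tens_rel R M q \<Longrightarrow> y - x \<in> tens_rel R M q"
  using tens_rel_uminus[of "x - y" R M q] by simp

lemma tens_rel_add_step:
  assumes "x - y - f \<in> tens_rel R M q" "f - z \<in> tens_rel R M q"
  shows "x - (y + z) \<in> tens_rel R M q"
proof -
  have "x - (y + z) = (x - y - f) + (f - z)" by (rule ext) simp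
  then show ?thesis using tens_rel_add[OF assms] by (simp only:)
qed

lemma tens_rel_sum:
  assumes "\<And>s. s \<in> S \<Longrightarrow> f s - g s \<in> tens_rel R M q"
  shows "sum f S - sum g S \<in> tens_rel R M q"
proof -
  have "(\<Sum>s\<in>S. f s - g s) \<in> tens_rel R M q"
    using assms by (induction S rule: infinite_finite_induct) (simp_all add: tens_rel_zero tens_rel_add)
  then show ?thesis by (simp add: sum_subtractf)
qed

lemma tens_rel_fsub: "y \<in> tens_rel R M q \<Longrightarrow> z \<in> tens_rel R M q \<Longrightarrow> fsub y z \<in> tens_rel R M q"
  unfolding fsub_eq_fadd_fneg by (intro tens_rel.plus tens_rel.uminus)

text \<open>The descent map \<open>\<phi> \<otimes> id : R x^k \<otimes> R x^n \<otimes> E \<rightarrow> R x^n \<otimes> E\<close> induced by an $R$-linear map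
  $\phi$ from $R$, viewed as a module through the $k$-fold Frobenius, to $R$;
  it is extended by zero to degrees below $k$.\<close>
definition descent :: "'a ring \<Rightarrow> nat \<Rightarrow> ('a \<Rightarrow> 'a) \<Rightarrow> nat \<times> 'a \<times> 'b \<Rightarrow> nat \<times> 'a \<times> 'b" where
  "descent R k \<phi> = (\<lambda>(j, r, e). if k \<le> j then (j - k, \<phi> r, e) else (0, \<zero>\<^bsub>R\<^esub>, e))"

text \<open>For q = p^k these are the p^(-k)-linear maps, also known as Cartier maps, from R to
  itself.\<close>

definition frobenius_form :: "'a ring \<Rightarrow> nat \<Rightarrow> ('a \<Rightarrow> 'a) \<Rightarrow> bool" where
  "frobenius_form R q \<phi> \<longleftrightarrow> \<phi> \<in> carrier R \<rightarrow> carrier R \<and>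
     (\<forall>r\<in>carrier R. \<forall>s\<in>carrier R. \<phi> (r \<oplus>\<^bsub>R\<^esub> s) = \<phi> r \<oplus>\<^bsub>R\<^esub> \<phi> s) \<and>
     (\<forall>r\<in>carrier R. \<forall>c\<in>carrier R. \<phi> (r \<otimes>\<^bsub>R\<^esub> c [^]\<^bsub>R\<^esub> q) = \<phi> r \<otimes>\<^bsub>R\<^esub> c)"

context
  fixes R :: "'a ring" and M :: "('a, 'b) module"
  assumes module: "module R M"
begin

interpretation module R M by (rule module)

text \<open>The additivity relation for 0 + 0 = 0 collapses to the negative of this generator.
  Descent produces such generators in degrees below k.\<close>

lemma gen_zero_in_tens_rel:
  assumes "x \<in> carrier M"
  shows "gen (i, \<zero>\<^bsub>R\<^esub>, x) \<in> tens_rel R M q"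
proof -
  have "fneg (fsub (fsub (gen (i, \<zero>\<^bsub>R\<^esub> \<oplus>\<^bsub>R\<^esub> \<zero>\<^bsub>R\<^esub>, x)) (gen (i, \<zero>\<^bsub>R\<^esub>, x))) (gen (i, \<zero>\<^bsub>R\<^esub>, x)))
      \<in> tens_rel R M q"
    by (intro tens_rel.uminus tens_rel.add_l R.zero_closed assms)
  then show ?thesis by (simp add: fneg_def fsub_def)
qed

text \<open>In degree i at least k, the power s^(p^i) is the p^k-th power of s^(p^(i-k)), so
  \<phi>(r s^(p^i)) = \<phi>(r) s^(p^(i-k)) and a balancing relation goes to one in degree i - k. In
  lower degrees all generators go to tensors with left factor zero.\<close>

lemma pushforward_descent:
  assumes \<phi>: "frobenius_form R (p ^ k) \<phi>" and y: "y \<in> phi_rel R M p"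
  shows "pushforward (descent R k \<phi>) y \<in> phi_rel R M p"
proof -
  have cl: "\<phi> r \<in> carrier R" if "r \<in> carrier R" for r using \<phi> that by (auto simp: frobenius_form_def)
  note push = fsub_eq_fadd_fneg pushforward_fadd pushforward_fneg pushforward_gen finite_support
  show ?thesis
    using y
  proof (induction rule: tens_rel.induct)
    case zero
    show ?case by (simp add: pushforward_zero tens_rel.zero)
  next
    case (add_l r s x i)
    show ?case
    proof (cases "k \<le> i")
      case True
      then have "pushforward (descent R k \<phi>) (fsub (fsub (gen (i, r \<oplus>\<^bsub>R\<^esub> s, x)) (gen (i, r, x))) (gen (i, s, x)))
        = fsub (fsub (gen (i - k, \<phi> r \<oplus>\<^bsub>R\<^esub> \<phi> s, x)) (gen (i - k, \<phi> r, x))) (gen (i - k, \<phi> s, x))"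
        using add_l \<phi> by (simp add: push descent_def frobenius_form_def)
      then show ?thesis using add_l cl by (simp add: tens_rel.add_l)
    next
      case False
      then have "pushforward (descent R k \<phi>) (fsub (fsub (gen (i, r \<oplus>\<^bsub>R\<^esub> s, x)) (gen (i, r, x))) (gen (i, s, x)))
        = fsub (fsub (gen (0, \<zero>\<^bsub>R\<^esub>, x)) (gen (0, \<zero>\<^bsub>R\<^esub>, x))) (gen (0, \<zero>\<^bsub>R\<^esub>, x))"
        by (simp add: push descent_def)
      then show ?thesis using add_l by (simp add: tens_rel_fsub gen_zero_in_tens_rel)
    qed
  next
    case (add_r r x x' i)
    show ?case
    proof (cases "k \<le> i")
      case True
      then have "pushforward (descent R k \<phi>) (fsub (fsub (gen (i, r, x \<oplus>\<^bsub>M\<^esub> x')) (gen (i, r, x))) (gen (i, r, x')))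
        = fsub (fsub (gen (i - k, \<phi> r, x \<oplus>\<^bsub>M\<^esub> x')) (gen (i - k, \<phi> r, x))) (gen (i - k, \<phi> r, x'))"
        by (simp add: push descent_def)
      then show ?thesis using add_r cl by (simp add: tens_rel.add_r)
    next
      case False
      then have "pushforward (descent R k \<phi>) (fsub (fsub (gen (i, r, x \<oplus>\<^bsub>M\<^esub> x')) (gen (i, r, x))) (gen (i, r, x')))
        = fsub (fsub (gen (0, \<zero>\<^bsub>R\<^esub>, x \<oplus>\<^bsub>M\<^esub> x')) (gen (0, \<zero>\<^bsub>R\<^esub>, x))) (gen (0, \<zero>\<^bsub>R\<^esub>, x'))"
        by (simp add: push descent_def)
      then show ?thesis using add_r by (simp add: tens_rel_fsub gen_zero_in_tens_rel)
    qed
  next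
    case (balanced r s x i)
    show ?case
    proof (cases "k \<le> i")
      case True
      then have "p ^ i = p ^ (i - k) * p ^ k" by (simp flip: power_add)
      then have "s [^]\<^bsub>R\<^esub> (p ^ i) = (s [^]\<^bsub>R\<^esub> (p ^ (i - k))) [^]\<^bsub>R\<^esub> (p ^ k)"
        using balanced by (simp add: R.nat_pow_pow)
      then have "\<phi> (r \<otimes>\<^bsub>R\<^esub> s [^]\<^bsub>R\<^esub> (p ^ i)) = \<phi> r \<otimes>\<^bsub>R\<^esub> s [^]\<^bsub>R\<^esub> (p ^ (i - k))"
        using balanced \<phi> by (simp add: frobenius_form_def)
      then have "pushforward (descent R k \<phi>) (fsub (gen (i, r \<otimes>\<^bsub>R\<^esub> s [^]\<^bsub>R\<^esub> (p ^ i), x)) (gen (i, r, s \<odot>\<^bsub>M\<^esub> x)))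
        = fsub (gen (i - k, \<phi> r \<otimes>\<^bsub>R\<^esub> s [^]\<^bsub>R\<^esub> (p ^ (i - k)), x)) (gen (i - k, \<phi> r, s \<odot>\<^bsub>M\<^esub> x))"
        using True by (simp add: push descent_def)
      then show ?thesis using balanced cl tens_rel.balanced[of "\<phi> r" R s x M "i - k" "\<lambda>n. p ^ n"] by simp
    next
      case False
      then have "pushforward (descent R k \<phi>) (fsub (gen (i, r \<otimes>\<^bsub>R\<^esub> s [^]\<^bsub>R\<^esub> (p ^ i), x)) (gen (i, r, s \<odot>\<^bsub>M\<^esub> x)))
        = fsub (gen (0, \<zero>\<^bsub>R\<^esub>, x)) (gen (0, \<zero>\<^bsub>R\<^esub>, s \<odot>\<^bsub>M\<^esub> x))"
        by (simp add: push descent_def)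
      then show ?thesis using balanced by (simp add: tens_rel_fsub gen_zero_in_tens_rel)
    qed
  next
    case (plus y z)
    then show ?case by (simp add: pushforward_fadd finite_support_tens_rel tens_rel.plus)
  next
    case (uminus y)
    then show ?case by (simp add: pushforward_fneg tens_rel.uminus)
  qed
qed

text \<open>Since $r x^k N = 0$, applying the descent map yields $\phi(r) N = 0$.\<close>
lemma phi_special_frobenius_form_closed:
  assumes \<phi>: "frobenius_form R (p ^ k) \<phi>"
    and a: "phi_special R M p a" and r: "r \<in> a"
  shows "\<phi> r \<in> a"
proof -
  obtain N where N: "phi_submodule R M p N" and aN: "a = phi_ann R M p N"
    using a by (auto simp: phi_special_def)
  have rR: "r \<in> carrier R" using r aN by (simp add: phi_ann_def)
  then have \<phi>r: "\<phi> r \<in> carrier R" using \<phi> by (auto simp: frobenius_form_def)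
  have "phi_act R p (\<phi> r) 0 y \<in> phi_rel R M p" if y: "y \<in> N" for y
  proof -
    have "in_free R M y" using N y by (auto simp: phi_submodule_def)
    then have fin: "finite {k. y k \<noteq> 0}" and supp: "\<And>n t e. y (n, t, e) \<noteq> 0 \<Longrightarrow> t \<in> carrier R"
      by (auto simp: in_free_def)
    \<comment> \<open>Stability of \<open>N\<close> under x^k raises \<open>y\<close> to degrees at
      least k, where descent is not the zero extension.\<close>
    have "phi_act R p \<one>\<^bsub>R\<^esub> k y \<in> N" using N y R.one_closed unfolding phi_submodule_def by blast
    then have "phi_act R p r 0 (phi_act R p \<one>\<^bsub>R\<^esub> k y) \<in> phi_rel R M p"
      using r aN by (simp add: phi_ann_def)
    then have "pushforward (descent R k \<phi>) (phi_act R p r 0 (phi_act R p \<one>\<^bsub>R\<^esub> k y)) \<in> phi_rel R M p"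
      by (rule pushforward_descent[OF \<phi>])
    \<comment> \<open>On a generator t x^n \<otimes> e the composite gives \<phi>(r t^(p^k)) =
      \<phi>(r) t back in degree n. Only generators in the support of \<open>y\<close> are compared,
      because linearity of \<open>\<phi>\<close> requires t in \<open>R\<close>.\<close>
    also have "pushforward (descent R k \<phi>) (phi_act R p r 0 (phi_act R p \<one>\<^bsub>R\<^esub> k y)) =
      phi_act R p (\<phi> r) 0 y"
      unfolding phi_act_eq_pushforward
    proof (subst pushforward_compose[OF fin], subst pushforward_compose[OF fin], rule pushforward_cong)
      fix i assume i: "y i \<noteq> 0"
      obtain n t e where [simp]: "i = (n, t, e)" by (cases i)
      have t: "t \<in> carrier R" using i supp by simp
      have "\<phi> (r \<otimes>\<^bsub>R\<^esub> t [^]\<^bsub>R\<^esub> (p ^ k)) = \<phi> r \<otimes>\<^bsub>R\<^esub> t"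
        using \<phi> rR t by (simp add: frobenius_form_def)
      then show "(descent R k \<phi> \<circ> ((\<lambda>(n, s, e). (0 + n, r \<otimes>\<^bsub>R\<^esub> s [^]\<^bsub>R\<^esub> (p ^ 0), e)) \<circ>
          (\<lambda>(n, s, e). (k + n, \<one>\<^bsub>R\<^esub> \<otimes>\<^bsub>R\<^esub> s [^]\<^bsub>R\<^esub> (p ^ k), e)))) i =
          (case i of (n, s, e) \<Rightarrow> (0 + n, \<phi> r \<otimes>\<^bsub>R\<^esub> s [^]\<^bsub>R\<^esub> (p ^ 0), e))"
        using t by (simp add: descent_def)
    qed
    finally show ?thesis .
  qed
  then show ?thesis using \<phi>r aN by (simp add: phi_ann_def)
qed

section \<open>Pure tensors expressed through generators and relations\<close>

lemma gen_zero_right_in_tens_rel: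
  assumes "r \<in> carrier R"
  shows "gen (i, r, \<zero>\<^bsub>M\<^esub>) \<in> tens_rel R M q"
proof -
  have "- (gen (i, r, \<zero>\<^bsub>M\<^esub> \<oplus>\<^bsub>M\<^esub> \<zero>\<^bsub>M\<^esub>) - gen (i, r, \<zero>\<^bsub>M\<^esub>) - gen (i, r, \<zero>\<^bsub>M\<^esub>)) \<in> tens_rel R M q"
    using tens_rel.add_r[of r R "\<zero>\<^bsub>M\<^esub>" M "\<zero>\<^bsub>M\<^esub>" i q] assms
    by (intro tens_rel_uminus) (simp add: fsub_eq_minus)
  then show ?thesis by simp
qed

lemma gen_finsum_left:
  assumes "finite S" "f \<in> S \<rightarrow> carrier R" "x \<in> carrier M"
  shows "gen (i, (\<Oplus>\<^bsub>R\<^esub>s\<in>S. f s), x) - (\<Sum>s\<in>S. gen (i, f s, x)) \<in> tens_rel R M q"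
  using assms(1,2)
proof (induction S rule: finite_induct)
  case empty
  show ?case using gen_zero_in_tens_rel assms by simp
next
  case (insert s S)
  let ?F = "\<Oplus>\<^bsub>R\<^esub>s\<in>S. f s"
  have f: "f s \<in> carrier R" "f \<in> S \<rightarrow> carrier R" and F: "?F \<in> carrier R" using insert by auto
  have "gen (i, f s \<oplus>\<^bsub>R\<^esub> ?F, x) - gen (i, f s, x) - gen (i, ?F, x) \<in> tens_rel R M q"
    using tens_rel.add_l[OF f(1) F assms(3), of i q] by (simp add: fsub_eq_minus)
  from tens_rel_add_step[OF this insert.IH[OF f(2)]] show ?case
    by (simp only: R.finsum_insert[OF insert.hyps f(2,1)] sum.insert[OF insert.hyps])
qed

lemma gen_finsum_right:
  assumes "finite S" "f \<in> S \<rightarrow> carrier M" "r \<in> carrier R"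
  shows "gen (i, r, (\<Oplus>\<^bsub>M\<^esub>s\<in>S. f s)) - (\<Sum>s\<in>S. gen (i, r, f s)) \<in> tens_rel R M q"
  using assms(1,2)
proof (induction S rule: finite_induct)
  case empty
  show ?case using gen_zero_right_in_tens_rel assms by simp
next
  case (insert s S)
  let ?F = "\<Oplus>\<^bsub>M\<^esub>s\<in>S. f s"
  have f: "f s \<in> carrier M" "f \<in> S \<rightarrow> carrier M" and F: "?F \<in> carrier M" using insert by auto
  have "gen (i, r, f s \<oplus>\<^bsub>M\<^esub> ?F) - gen (i, r, f s) - gen (i, r, ?F) \<in> tens_rel R M q"
    using tens_rel.add_r[OF assms(3) f(1) F, of i q] by (simp add: fsub_eq_minus)
  from tens_rel_add_step[OF this insert.IH[OF f(2)]] show ?case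
    by (simp only: M.finsum_insert[OF insert.hyps f(2,1)] sum.insert[OF insert.hyps])
qed

text \<open>The balancing relation carries each coefficient across the tensor sign, where it acts
  without its power.\<close>

lemma gen_combination:
  assumes S: "finite S" "S \<subseteq> carrier R" and c: "c \<in> S \<rightarrow> carrier R" and x: "x \<in> carrier M"
  shows "gen (i, (\<Oplus>\<^bsub>R\<^esub>s\<in>S. s \<otimes>\<^bsub>R\<^esub> c s [^]\<^bsub>R\<^esub> q i), x) - (\<Sum>s\<in>S. gen (i, s, c s \<odot>\<^bsub>M\<^esub> x))
    \<in> tens_rel R M q"
proof (rule tens_rel_trans[OF gen_finsum_left tens_rel_sum])
  fix s assume "s \<in> S"
  then show "gen (i, s \<otimes>\<^bsub>R\<^esub> c s [^]\<^bsub>R\<^esub> q i, x) - gen (i, s, c s \<odot>\<^bsub>M\<^esub> x) \<in> tens_rel R M q"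
    using tens_rel.balanced[of s R "c s" x M i q] S c x by (auto simp: fsub_eq_minus)
qed (use assms in auto)

text \<open>Each \<open>b\<close> is a relation between the generators in \<open>S\<close>.
  Expanding the right factors and exchanging the sums gives, for each \<open>b\<close>, the tensor
  of that relation with \<open>f b\<close>, which is zero.\<close>

lemma gen_combination_vanish:
  assumes S: "finite S" "S \<subseteq> carrier R" and c: "c \<in> S \<rightarrow> carrier R" and x: "x \<in> carrier M"
    and B: "finite B" "\<And>b. b \<in> B \<Longrightarrow> b \<in> S \<rightarrow> carrier R"
      "\<And>b. b \<in> B \<Longrightarrow> (\<Oplus>\<^bsub>R\<^esub>s\<in>S. s \<otimes>\<^bsub>R\<^esub> b s [^]\<^bsub>R\<^esub> q i) = \<zero>\<^bsub>R\<^esub>"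
    and f: "f \<in> B \<rightarrow> carrier M"
    and eq: "\<And>s. s \<in> S \<Longrightarrow> c s \<odot>\<^bsub>M\<^esub> x = (\<Oplus>\<^bsub>M\<^esub>b\<in>B. b s \<odot>\<^bsub>M\<^esub> f b)"
  shows "gen (i, (\<Oplus>\<^bsub>R\<^esub>s\<in>S. s \<otimes>\<^bsub>R\<^esub> c s [^]\<^bsub>R\<^esub> q i), x) \<in> tens_rel R M q"
proof -
  have bs: "b s \<in> carrier R" if "b \<in> B" "s \<in> S" for b s using B(2)[OF that(1)] that(2) by auto
  have fb: "f b \<in> carrier M" if "b \<in> B" for b using f that by auto
  have "(\<Sum>s\<in>S. gen (i, s, c s \<odot>\<^bsub>M\<^esub> x)) - (\<Sum>s\<in>S. \<Sum>b\<in>B. gen (i, s, b s \<odot>\<^bsub>M\<^esub> f b)) \<in> tens_rel R M q"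
  proof (rule tens_rel_sum)
    fix s assume s: "s \<in> S"
    show "gen (i, s, c s \<odot>\<^bsub>M\<^esub> x) - (\<Sum>b\<in>B. gen (i, s, b s \<odot>\<^bsub>M\<^esub> f b)) \<in> tens_rel R M q"
      unfolding eq[OF s] using s S bs fb by (intro gen_finsum_right B(1)) auto
  qed
  from tens_rel_trans[OF gen_combination[OF S c x] this]
  have 1: "gen (i, (\<Oplus>\<^bsub>R\<^esub>s\<in>S. s \<otimes>\<^bsub>R\<^esub> c s [^]\<^bsub>R\<^esub> q i), x) - (\<Sum>s\<in>S. \<Sum>b\<in>B. gen (i, s, b s \<odot>\<^bsub>M\<^esub> f b))
    \<in> tens_rel R M q" .
  have "(\<Sum>b\<in>B. \<Sum>s\<in>S. gen (i, s, b s \<odot>\<^bsub>M\<^esub> f b)) - (\<Sum>b\<in>B. 0) \<in> tens_rel R M q"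
  proof (rule tens_rel_sum)
    fix b assume b: "b \<in> B"
    have "gen (i, \<zero>\<^bsub>R\<^esub>, f b) - (\<Sum>s\<in>S. gen (i, s, b s \<odot>\<^bsub>M\<^esub> f b)) \<in> tens_rel R M q"
      using gen_combination[OF S B(2)[OF b] fb[OF b], of i q] unfolding B(3)[OF b] .
    from tens_rel_trans[OF tens_rel_sym[OF this], of 0]
    show "(\<Sum>s\<in>S. gen (i, s, b s \<odot>\<^bsub>M\<^esub> f b)) - 0 \<in> tens_rel R M q"
      using gen_zero_in_tens_rel[OF fb[OF b], of i q] by simp
  qed
  then have "(\<Sum>s\<in>S. \<Sum>b\<in>B. gen (i, s, b s \<odot>\<^bsub>M\<^esub> f b)) - 0 \<in> tens_rel R M q"
    by (subst sum.swap) simp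
  from tens_rel_trans[OF 1 this] show ?thesis by simp
qed

text \<open>The map \<open>comb\<close> presents \<open>R\<close>, viewed through the k-fold
  Frobenius, as a quotient of a free module on \<open>S\<close> with relations \<open>K\<close>. The
  hypothesis on forms is the compatibility condition of the system that writes
  \<open>c s \<odot> x\<close> as combinations of relations.\<close>

lemma gen_vanish_if_frobenius_forms_vanish:
  assumes "noetherian_ring R" and inj: "injective_module R M"
    and p: "Factorial_Ring.prime p" and char: "[p] \<cdot>\<^bsub>R\<^esub> \<one>\<^bsub>R\<^esub> = \<zero>\<^bsub>R\<^esub>" and fin: "F_finite R p"
    and r: "r \<in> carrier R" and x: "x \<in> carrier M"
    and forms: "\<And>\<phi>. frobenius_form R (p ^ k) \<phi> \<Longrightarrow> \<phi> r \<odot>\<^bsub>M\<^esub> x = \<zero>\<^bsub>M\<^esub>"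
  shows "gen (k, r, x) \<in> phi_rel R M p"
proof -
  interpret noetherian_ring R by fact
  note dream = R.freshmans_dream_power[OF p char]
  have q0: "0 < p ^ k" using p by (simp add: prime_gt_0_nat)
  obtain S where S: "finite S" "S \<subseteq> carrier R"
    and gens: "\<forall>r \<in> carrier R. \<exists>c. c \<in> S \<rightarrow> carrier R \<and>
      r = (\<Oplus>\<^bsub>R\<^esub> s \<in> S. s \<otimes>\<^bsub>R\<^esub> (c s [^]\<^bsub>R\<^esub> (p ^ k)))"
    using F_finite_power[OF R.cring_axioms p char fin, of k] unfolding F_finite_def by (elim exE conjE)
  have SR: "s \<in> carrier R" if "s \<in> S" for s using S that by auto
  define V where "V = ((UNIV :: 'a set) \<rightarrow> carrier R)"
  have VD: "v s \<in> carrier R" if "v \<in> V" for v s using that by (auto simp: V_def)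
  define comb where "comb c = (\<Oplus>\<^bsub>R\<^esub> s \<in> S. s \<otimes>\<^bsub>R\<^esub> (c s [^]\<^bsub>R\<^esub> (p ^ k)))" for c
  have comb_closed: "comb c \<in> carrier R" if "c \<in> V" for c
    unfolding comb_def using VD[OF that] SR by (intro R.finsum_closed) auto
  have comb_surj: "\<exists>c. c \<in> V \<and> comb c = y" if y: "y \<in> carrier R" for y
  proof -
    obtain c where c: "c \<in> S \<rightarrow> carrier R" "y = comb c"
      using bspec[OF gens y] unfolding comb_def by (elim exE conjE)
    have "comb (\<lambda>s. if s \<in> S then c s else \<zero>\<^bsub>R\<^esub>) = comb c"
      unfolding comb_def using c(1) SR by (intro R.finsum_cong') auto
    then show ?thesis using c
      by (intro exI[of _ "\<lambda>s. if s \<in> S then c s else \<zero>\<^bsub>R\<^esub>"]) (auto simp: V_def)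
  qed
  have comb_add: "comb (\<lambda>s. c s \<oplus>\<^bsub>R\<^esub> d s) = comb c \<oplus>\<^bsub>R\<^esub> comb d" if "c \<in> V" "d \<in> V" for c d
  proof -
    have "comb (\<lambda>s. c s \<oplus>\<^bsub>R\<^esub> d s) =
        (\<Oplus>\<^bsub>R\<^esub>s\<in>S. s \<otimes>\<^bsub>R\<^esub> (c s [^]\<^bsub>R\<^esub> (p ^ k)) \<oplus>\<^bsub>R\<^esub> s \<otimes>\<^bsub>R\<^esub> (d s [^]\<^bsub>R\<^esub> (p ^ k)))"
      unfolding comb_def using VD that SR
      by (intro R.finsum_cong') (auto simp: dream R.r_distr)
    also have "\<dots> = comb c \<oplus>\<^bsub>R\<^esub> comb d"
      unfolding comb_def using VD that SR by (intro R.finsum_addf) auto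
    finally show ?thesis .
  qed
  have comb_smult: "comb (\<lambda>s. b \<otimes>\<^bsub>R\<^esub> c s) = comb c \<otimes>\<^bsub>R\<^esub> b [^]\<^bsub>R\<^esub> (p ^ k)"
    if "c \<in> V" "b \<in> carrier R" for b c
  proof -
    have "comb (\<lambda>s. b \<otimes>\<^bsub>R\<^esub> c s) = (\<Oplus>\<^bsub>R\<^esub>s\<in>S. s \<otimes>\<^bsub>R\<^esub> (c s [^]\<^bsub>R\<^esub> (p ^ k)) \<otimes>\<^bsub>R\<^esub> b [^]\<^bsub>R\<^esub> (p ^ k))"
      unfolding comb_def using VD that SR
      by (intro R.finsum_cong') (auto simp: R.nat_pow_distrib R.m_ac)
    also have "\<dots> = comb c \<otimes>\<^bsub>R\<^esub> b [^]\<^bsub>R\<^esub> (p ^ k)"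
      unfolding comb_def using VD that SR S(1) by (intro R.finsum_ldistr[symmetric]) auto
    finally show ?thesis .
  qed
  have Vsub: "(\<lambda>s. c s \<oplus>\<^bsub>R\<^esub> d s) \<in> V" "(\<lambda>s. b \<otimes>\<^bsub>R\<^esub> c s) \<in> V"
    if "c \<in> V" "d \<in> V" "b \<in> carrier R" for b c d
    using that by (auto simp: V_def)
  define K where "K = {c \<in> V. comb c = \<zero>\<^bsub>R\<^esub>}"
  have "comb (\<lambda>_. \<zero>\<^bsub>R\<^esub>) = \<zero>\<^bsub>R\<^esub>"
    unfolding comb_def using SR q0 by (intro R.add.finprod_one_eqI) (auto simp: R.nat_pow_zero)
  then have "vec_submodule R K"
    unfolding vec_submodule_def K_def using Vsub
    by (auto simp: comb_add comb_smult) (auto simp: V_def)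
  from vec_orthogonal_finite[OF R.cring_axioms S(1) this]
  obtain B where B: "finite B" "B \<subseteq> K" and orth: "\<forall>v\<in>UNIV \<rightarrow> carrier R.
    (\<forall>k\<in>B. vec_dot R S k v = \<zero>\<^bsub>R\<^esub>) \<longrightarrow> (\<forall>k\<in>K. vec_dot R S k v = \<zero>\<^bsub>R\<^esub>)"
    by (elim exE conjE)
  obtain c where c: "c \<in> V" "comb c = r" using comb_surj[OF r] by blast
  have "\<exists>f \<in> UNIV \<rightarrow> carrier M. \<forall>s\<in>S. c s \<odot>\<^bsub>M\<^esub> x = (\<Oplus>\<^bsub>M\<^esub>b\<in>B. b s \<odot>\<^bsub>M\<^esub> f b)"
  proof (rule injective_module_linear_system[OF module inj S(1) B(1)])
    show "B \<subseteq> UNIV \<rightarrow> carrier R" using B(2) by (auto simp: K_def V_def)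
    show "(\<lambda>s. c s \<odot>\<^bsub>M\<^esub> x) \<in> UNIV \<rightarrow> carrier M" using VD[OF c(1)] x by auto
    \<comment> \<open>Orthogonality to \<open>B\<close> extends to all relations, so pairing with
      \<open>v\<close> factors through \<open>comb\<close> and defines a form.\<close>
    fix v assume v: "v \<in> UNIV \<rightarrow> carrier R" and vB: "\<forall>k\<in>B. vec_dot R S k v = \<zero>\<^bsub>R\<^esub>"
    have vK: "\<And>k. k \<in> K \<Longrightarrow> vec_dot R S k v = \<zero>\<^bsub>R\<^esub>" using orth v vB by blast
    have dot_closed: "vec_dot R S d v \<in> carrier R" if "d \<in> V" for d
      using that v by (simp add: V_def)
    have dot_add: "vec_dot R S (\<lambda>s. d s \<oplus>\<^bsub>R\<^esub> d' s) v = vec_dot R S d v \<oplus>\<^bsub>R\<^esub> vec_dot R S d' v"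
      if "d \<in> V" "d' \<in> V" for d d'
      using R.vec_dot_add[of v d d' S] R.vec_dot_commute[OF v, of _ S] Vsub(1)[OF that R.zero_closed] that v
      by (simp add: V_def)
    have dot_smult: "vec_dot R S (\<lambda>s. b \<otimes>\<^bsub>R\<^esub> d s) v = b \<otimes>\<^bsub>R\<^esub> vec_dot R S d v"
      if "d \<in> V" "b \<in> carrier R" for d b
      using R.vec_dot_smult[OF S(1), of v d b] R.vec_dot_commute[OF v, of _ S] Vsub(2)[OF that(1) that] that v
      by (simp add: V_def)
    have unique: "vec_dot R S d v = vec_dot R S d' v" if d: "d \<in> V" "d' \<in> V" "comb d = comb d'" for d d'
    proof -
      let ?n = "\<lambda>s. (\<ominus>\<^bsub>R\<^esub> \<one>\<^bsub>R\<^esub>) \<otimes>\<^bsub>R\<^esub> d' s"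
      \<comment> \<open>The scalar -1 leaves \<open>comb\<close> as (-1)^(p^k). Replacing
        \<open>d'\<close> by \<open>d\<close> in the negated summand does not change the value, and
        the sum then becomes the zero vector, so this power need not be evaluated.\<close>
      let ?m = "\<lambda>s. (\<ominus>\<^bsub>R\<^esub> \<one>\<^bsub>R\<^esub>) \<otimes>\<^bsub>R\<^esub> d s"
      have n: "?n \<in> V" "?m \<in> V" using Vsub(2) d by auto
      have "comb (\<lambda>s. d s \<oplus>\<^bsub>R\<^esub> ?n s) = comb (\<lambda>s. d s \<oplus>\<^bsub>R\<^esub> ?m s)"
        using d n by (simp add: comb_add comb_smult)
      also have "\<dots> = comb (\<lambda>_. \<zero>\<^bsub>R\<^esub>)"
        using VD[OF d(1)] by (simp add: R.l_minus R.r_neg)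
      finally have "(\<lambda>s. d s \<oplus>\<^bsub>R\<^esub> ?n s) \<in> K"
        using Vsub(1)[OF d(1) n(1) R.zero_closed] \<open>comb (\<lambda>_. \<zero>\<^bsub>R\<^esub>) = \<zero>\<^bsub>R\<^esub>\<close> by (simp add: K_def)
      from vK[OF this] have "vec_dot R S d v \<oplus>\<^bsub>R\<^esub> \<ominus>\<^bsub>R\<^esub> vec_dot R S d' v = \<zero>\<^bsub>R\<^esub>"
        using d n dot_closed by (simp add: dot_add dot_smult R.l_minus)
      then show ?thesis
        using R.minus_equality[of "vec_dot R S d v" "\<ominus>\<^bsub>R\<^esub> vec_dot R S d' v"] dot_closed d by simp
    qed
    \<comment> \<open>The chosen coefficient vector is immaterial by \<open>unique\<close>, hence
      \<open>\<phi>\<close> takes the value \<open>v s\<close> on a generator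
      \<open>s\<close>.\<close>
    define \<phi> where "\<phi> y = vec_dot R S (SOME d. d \<in> V \<and> comb d = y) v" for y
    have \<phi>: "\<phi> (comb d) = vec_dot R S d v" if d: "d \<in> V" for d
    proof -
      have "\<exists>d'. d' \<in> V \<and> comb d' = comb d" using d by blast
      from someI_ex[OF this] show ?thesis unfolding \<phi>_def using d by (intro unique) auto
    qed
    have "frobenius_form R (p ^ k) \<phi>"
      unfolding frobenius_form_def
    proof (intro conjI ballI funcsetI)
      fix y assume "y \<in> carrier R"
      then obtain d where d: "d \<in> V" "y = comb d" using comb_surj by blast
      then show "\<phi> y \<in> carrier R" by (simp add: \<phi> dot_closed)
      show "\<phi> (y \<otimes>\<^bsub>R\<^esub> b [^]\<^bsub>R\<^esub> (p ^ k)) = \<phi> y \<otimes>\<^bsub>R\<^esub> b" if b: "b \<in> carrier R" for b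
        using d b Vsub(2)[OF d(1) d(1) b] dot_closed[OF d(1)]
        by (simp add: \<phi> dot_smult R.m_comm flip: comb_smult)
      fix z assume "z \<in> carrier R"
      then obtain d' where d': "d' \<in> V" "z = comb d'" using comb_surj by blast
      then show "\<phi> (y \<oplus>\<^bsub>R\<^esub> z) = \<phi> y \<oplus>\<^bsub>R\<^esub> \<phi> z"
        using d Vsub(1)[OF d(1) d'(1) R.zero_closed] by (simp add: \<phi> dot_add flip: comb_add)
    qed
    \<comment> \<open>As \<open>c\<close> represents \<open>r\<close>, the value of the form at
      \<open>r\<close> is the pairing of \<open>c\<close> with \<open>v\<close>; expanding it
      against \<open>x\<close> gives the compatibility condition.\<close>
    from forms[OF this] have "vec_dot R S c v \<odot>\<^bsub>M\<^esub> x = \<zero>\<^bsub>M\<^esub>"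
      using \<phi>[OF c(1)] c(2) by simp
    moreover have "vec_dot R S c v \<odot>\<^bsub>M\<^esub> x = (\<Oplus>\<^bsub>M\<^esub>s\<in>S. (c s \<otimes>\<^bsub>R\<^esub> v s) \<odot>\<^bsub>M\<^esub> x)"
      unfolding vec_dot_def using VD[OF c(1)] v x by (intro finsum_smult_rdistr S(1)) auto
    moreover have "\<dots> = (\<Oplus>\<^bsub>M\<^esub>s\<in>S. v s \<odot>\<^bsub>M\<^esub> (c s \<odot>\<^bsub>M\<^esub> x))"
    proof (intro M.finsum_cong')
      fix s
      have "v s \<in> carrier R" "c s \<in> carrier R" using v VD[OF c(1)] by auto
      then show "(c s \<otimes>\<^bsub>R\<^esub> v s) \<odot>\<^bsub>M\<^esub> x = v s \<odot>\<^bsub>M\<^esub> (c s \<odot>\<^bsub>M\<^esub> x)"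
        using x by (simp add: R.m_comm[of "c s"] smult_assoc1)
    qed (use v VD[OF c(1)] x in auto)
    ultimately show "(\<Oplus>\<^bsub>M\<^esub>s\<in>S. v s \<odot>\<^bsub>M\<^esub> (c s \<odot>\<^bsub>M\<^esub> x)) = \<zero>\<^bsub>M\<^esub>" by simp
  qed
  then obtain f where f: "f \<in> UNIV \<rightarrow> carrier M"
    "\<forall>s\<in>S. c s \<odot>\<^bsub>M\<^esub> x = (\<Oplus>\<^bsub>M\<^esub>b\<in>B. b s \<odot>\<^bsub>M\<^esub> f b)" by (elim bexE)
  have "gen (k, (\<Oplus>\<^bsub>R\<^esub>s\<in>S. s \<otimes>\<^bsub>R\<^esub> c s [^]\<^bsub>R\<^esub> (p ^ k)), x) \<in> phi_rel R M p"
  proof (rule gen_combination_vanish[OF S _ x B(1)])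
    show "c \<in> S \<rightarrow> carrier R" using VD[OF c(1)] by auto
    show "b \<in> S \<rightarrow> carrier R" if "b \<in> B" for b using that B(2) VD by (auto simp: K_def)
    show "(\<Oplus>\<^bsub>R\<^esub>s\<in>S. s \<otimes>\<^bsub>R\<^esub> b s [^]\<^bsub>R\<^esub> (p ^ k)) = \<zero>\<^bsub>R\<^esub>" if "b \<in> B" for b
      using that B(2) by (auto simp: K_def comb_def)
    show "f \<in> B \<rightarrow> carrier M" using f(1) by auto
    show "c s \<odot>\<^bsub>M\<^esub> x = (\<Oplus>\<^bsub>M\<^esub>b\<in>B. b s \<odot>\<^bsub>M\<^esub> f b)" if "s \<in> S" for s
      using f(2) that by blast
  qed
  then show ?thesis using c(2) by (simp add: comb_def)
qed

end

theorem theorem3p4: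
  fixes R :: "'a ring" and m :: "'a set" and p :: nat and E :: "('a, 'b) module"
  assumes "char_p_local_noetherian R m p"
    and "F_pure R p"
    and "F_finite R p"
    and "injective_hull_residue R m E"
  shows "\<forall>a. phi_special R E p a \<longrightarrow> fully_phi_special R E p a"
proof (intro allI impI)
  fix a assume a: "phi_special R E p a"
  have R: "cring R" "noetherian_ring R" "Factorial_Ring.prime p" "[p] \<cdot>\<^bsub>R\<^esub> \<one>\<^bsub>R\<^esub> = \<zero>\<^bsub>R\<^esub>"
    using assms(1) by (auto simp: char_p_local_noetherian_def)
  have E: "module R E" "injective_module R E"
    using assms(4) by (auto simp: injective_hull_residue_def)
  interpret module R E by fact
  \<comment> \<open>Each form maps \<open>r\<close> to another element of \<open>a\<close>, which
    annihilates \<open>e\<close>; this is what the vanishing criterion asks for.\<close>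
  have "gen (k, r, e) \<in> phi_rel R E p"
    if "e \<in> carrier E" "\<forall>r\<in>a. r \<odot>\<^bsub>E\<^esub> e = \<zero>\<^bsub>E\<^esub>" "r \<in> carrier R" "r \<in> a" for e r k
    using that phi_special_frobenius_form_closed[OF E(1) _ a]
    by (intro gen_vanish_if_frobenius_forms_vanish[OF E(1) R(2) E(2) R(3,4) assms(3)]) auto
  moreover have "a \<subseteq> carrier R"
    using a by (auto simp: phi_special_def phi_ann_def)
  \<comment> \<open>Acting by r x^k on the generator 1 \<otimes> e yields r x^k \<otimes> e, because
    powers of 1 are 1.\<close>
  ultimately show "fully_phi_special R E p a"
    unfolding fully_phi_special_def phi_act_eq_pushforward pushforward_gen by auto
qed

end
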